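(* Let $M$ be a compact separable metric space with Borel $\sigma$-algebra $\mathcal B$, and $\tau:M\to M$ continuous and uniquely ergodic with (unique) invariant Borel probability measure $\mu$. Let $(\Omega,\mathcal F,P)$ be a probability space and $(\theta_k)_{k\in\mathbb{Z}^d}$ a $d$-parameter group of $P$-preserving transformations such that $P$ is strongly mixing with respect to $(\theta_k)_{k\in\mathbb{Z}^d}$. Let $\kappa:M\to\mathbb{Z}^d$ be $\mathcal B$-measurable, $\kappa_n=\sum_{i=0}^{n-1}\kappa\circ\tau^i$, and assume that for all $m\in\mathbb{N}$ $$\lim_{n\to\infty}\frac1{n^2}\sup_{t\in M}\big|\{1\le i,j\le n:\ \|\kappa_i(t)-\kappa_j(t)\|\le m\}\big|=0.$$ Let $1\le p<\infty$. Then for every $\mathcal B\otimes\mathcal F$-measurable function $F$ on $M\times\Omega$ such that $\sup_{t\in M}|F(t,\cdot)|\in L^p(\Omega,\mathcal F,P)$ and $F(\cdot,\omega)$ is continuous on $M$ for $P$-almost every $\omega$, $$\sup_{t\in M}\Big\|\frac1n\sum_{i=0}^{n-1}F\big(\tau^i(t),\theta_{\kappa_i(t)}\,\cdot\,\big)-\bar E[F]\Big\|_{L^p(P)}\to0\quad(n\to\infty),$$ where $\bar E[F]=\int F\,d(\mu\otimes P)$.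
   Context: $\|\cdot\|$ is the maximum norm on $\mathbb{Z}^d$. A $d$-parameter group of $P$-preserving transformations: each $\theta_k$ measurable and $P$-preserving, $\theta_0=\mathrm{Id}$, $\theta_k\circ\theta_l=\theta_{k+l}$, $\theta_{-k}=\theta_k^{-1}$. $P$ is strongly mixing w.r.t. $(\theta_k)$ if $P(A\cap\theta_k^{-1}B)\to P(A)P(B)$ as $\|k\|\to\infty$ for all $A,B\in\mathcal F$. A continuous map of a compact metrizable space is uniquely ergodic if it has exactly one invariant Borel probability measure. *)

theory Defs
  imports "HOL-Probability.Probability"
begin

definition maxnorm :: "int ^ 'd \<Rightarrow> int" where
  "maxnorm k = Max (range (\<lambda>i. \<bar>k $ i\<bar>))"

definition invariant_borel_prob :: "('m::metric_space \<Rightarrow> 'm) \<Rightarrow> 'm measure \<Rightarrow> bool" where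
  "invariant_borel_prob \<tau> \<nu> \<longleftrightarrow>
     prob_space \<nu> \<and> sets \<nu> = sets (borel :: 'm measure) \<and> distr \<nu> borel \<tau> = \<nu>"

definition uniquely_ergodic :: "('m::metric_space \<Rightarrow> 'm) \<Rightarrow> bool" where
  "uniquely_ergodic \<tau> \<longleftrightarrow> continuous_on UNIV \<tau> \<and> (\<exists>!\<nu>. invariant_borel_prob \<tau> \<nu>)"

definition pres_group :: "'w measure \<Rightarrow> (int ^ 'd \<Rightarrow> 'w \<Rightarrow> 'w) \<Rightarrow> bool" where
  "pres_group P \<theta> \<longleftrightarrow>
     (\<forall>k. \<theta> k \<in> measurable P P \<and> distr P P (\<theta> k) = P) \<and>
     \<theta> 0 = id \<and> (\<forall>k l. \<theta> k \<circ> \<theta> l = \<theta> (k + l)) \<and>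
     (\<forall>k. bij (\<theta> k) \<and> \<theta> (- k) = inv (\<theta> k))"

definition strongly_mixing :: "'w measure \<Rightarrow> (int ^ 'd \<Rightarrow> 'w \<Rightarrow> 'w) \<Rightarrow> bool" where
  "strongly_mixing P \<theta> \<longleftrightarrow>
     (\<forall>A\<in>sets P. \<forall>B\<in>sets P.
        ((\<lambda>k. measure P (A \<inter> (\<theta> k -` B \<inter> space P))) \<longlongrightarrow> measure P A * measure P B)
          (filtercomap maxnorm at_top))"

definition kappa_sum :: "('m \<Rightarrow> 'm) \<Rightarrow> ('m \<Rightarrow> int ^ 'd) \<Rightarrow> nat \<Rightarrow> 'm \<Rightarrow> int ^ 'd" where
  "kappa_sum \<tau> \<kappa> n t = (\<Sum>i<n. \<kappa> ((\<tau> ^^ i) t))"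

end

theory Submission
  imports Defs
begin

text \<open>
  Write \<open>a t\<close> for the mean of \<open>F (t, _)\<close> under \<open>P\<close>. By dominated convergence and compactness,
  \<open>t \<mapsto> F (t, _)\<close> is uniformly continuous from \<open>M\<close> into \<open>L\<^sup>p\<close>, so \<open>a\<close> is continuous and all the functions
  \<open>F (t, _)\<close> lie within \<open>\<epsilon>\<close> of finitely many simple functions. The averages of \<open>a\<close> along the orbits of \<open>\<tau>\<close>
  converge uniformly by unique ergodicity. What remains is, up to \<open>\<epsilon>\<close>, an average of centred simple functions
  from a finite family, shifted by \<open>\<theta>\<close>; strong mixing bounds the correlation of any two terms whose displacement
  is large, and the hypothesis on \<open>\<kappa>\<close> says that all other pairs are negligible, so the second moment tends to
  \<open>0\<close> uniformly in the starting point. Boundedness upgrades this from \<open>L\<^sup>2\<close> to \<open>L\<^sup>p\<close>.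

  Uniform convergence under unique ergodicity needs weak compactness of the probability measures on \<open>M\<close>.
  It is obtained from Helly's selection theorem on the real line: the ternary expansion recording which balls of
  a countable base contain \<open>t\<close> is a code of \<open>t\<close> whose inverse extends continuously to the closure of the codes.
\<close>

section \<open>Real codes for compact metric spaces\<close>

text \<open>If \<open>j\<close> is the first index where the digits differ, its term contributes
  exactly \<open>1 / 3 ^ j\<close>, while all later terms together contribute at most half of that.
  The sums are then at least \<open>1 / (2 * 3 ^ j)\<close> apart, which is too far when
  \<open>j \<le> N\<close>. Base 3 with digits 0 and 1 leaves this gap; in base 2 the tail could
  cancel the leading term.\<close>

lemma ternary_digits_eq:
  fixes a b :: "nat \<Rightarrow> bool"
  assumes "\<bar>(\<Sum>i. of_bool (a i) / 3 ^ i) - (\<Sum>i. of_bool (b i) / 3 ^ i :: real)\<bar> < 1 / (2 * 3 ^ N)" "i \<le> N"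
  shows "a i = b i"
proof (rule ccontr)
  assume "a i \<noteq> b i"
  define j where "j = (LEAST j. a j \<noteq> b j)"
  have aj: "a j \<noteq> b j" and "j \<le> i" unfolding j_def using \<open>a i \<noteq> b i\<close>
    by (rule LeastI, rule Least_le)
  have below: "a l = b l" if "l < j" for l
    using not_less_Least that unfolding j_def by blast
  have geo: "summable (\<lambda>i. (1/3::real) ^ i)" by (rule summable_geometric) simp
  have sm: "summable (\<lambda>i. of_bool (a i) / 3 ^ i :: real)" for a :: "nat \<Rightarrow> bool"
    by (rule summable_comparison_test'[OF geo, of 0]) (auto simp: field_simps)
  define d :: "nat \<Rightarrow> real" where "d i = of_bool (a i) / 3 ^ i - of_bool (b i) / 3 ^ i" for i
  have d: "summable d" unfolding d_def by (intro summable_diff sm)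
  have dle: "\<bar>d i\<bar> \<le> (1/3) ^ i" for i unfolding d_def by (auto simp: field_simps)
  have "suminf d = (\<Sum>i. d (i + Suc j)) + sum d {..<Suc j}"
    by (rule suminf_split_initial_segment[OF d])
  moreover have "sum d {..<Suc j} = d j" using below by (simp add: d_def)
  moreover have "\<bar>d j\<bar> = 1 / 3 ^ j" using aj by (auto simp: d_def)
  moreover have "\<bar>\<Sum>i. d (i + Suc j)\<bar> \<le> (\<Sum>i. (1/3) ^ (i + Suc j))"
    using norm_suminf_le[of "\<lambda>i. d (i + Suc j)" "\<lambda>i. (1/3) ^ (i + Suc j)"]
      summable_ignore_initial_segment[OF geo, of "Suc j"] dle by (simp del: power_Suc add_Suc_right)
  moreover have "(\<Sum>i. (1/3) ^ (i + Suc j)) = (1/3::real) ^ Suc j * (\<Sum>i. (1/3) ^ i)"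
    by (subst suminf_mult[OF geo, symmetric]) (simp add: power_add mult_ac)
  moreover have "(\<Sum>i. (1/3::real) ^ i) = 3/2" by (subst suminf_geometric) auto
  moreover have "(1/3::real) ^ Suc j * (3/2) = 1 / (2 * 3 ^ j)" by (simp add: power_divide)
  moreover have "1 / (2 * 3 ^ N) \<le> 1 / (2 * 3 ^ j :: real)"
    using \<open>j \<le> i\<close> \<open>i \<le> N\<close> by (intro divide_left_mono) auto
  moreover have "suminf d = (\<Sum>i. of_bool (a i) / 3 ^ i) - (\<Sum>i. of_bool (b i) / 3 ^ i)"
    unfolding d_def by (rule suminf_diff[symmetric, OF sm sm])
  moreover have "1 / (2 * 3 ^ j) + 1 / (2 * 3 ^ j) = 1 / (3 ^ j :: real)" by simp
  \<comment> \<open>The leading term is twice \<open>1 / (2 * 3 ^ j)\<close>, but the tail and the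
    total can only account for less than that.\<close>
  ultimately have "\<bar>suminf d - d j\<bar> \<le> 1 / (2 * 3 ^ j)" "\<bar>suminf d\<bar> < 1 / (2 * 3 ^ j)"
    "\<bar>d j\<bar> = 1 / (2 * 3 ^ j) + 1 / (2 * 3 ^ j)"
    using assms(1) by (simp_all del: power_Suc)
  then show False by linarith
qed

text \<open>Total boundedness gives, for each \<open>n\<close>, a finite cover by balls of radius
  \<open>1 / (n + 1)\<close>. The digits of \<open>c t\<close> record which of these countably many
  balls contain \<open>t\<close>. The code itself may jump; what is controlled is its inverse, since
  close codes share their first digits and so place both points in one small ball.\<close>

lemma compact_real_coding:
  assumes "compact (UNIV :: 'm::metric_space set)"
  obtains c :: "'m::metric_space \<Rightarrow> real" where "\<And>t. 0 \<le> c t" "\<And>t. c t \<le> 2"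
    "\<And>e. e > 0 \<Longrightarrow> \<exists>d>0. \<forall>s t. \<bar>c s - c t\<bar> < d \<longrightarrow> dist s t < e"
proof -
  have "\<exists>k. finite k \<and> (UNIV :: 'm set) \<subseteq> (\<Union>x\<in>k. ball x (1 / real (Suc n)))" for n
    using assms unfolding compact_eq_totally_bounded
    by (meson of_nat_0_less_iff zero_less_Suc zero_less_divide_1_iff)
  then obtain k where k: "\<And>n. finite (k n)" "\<And>n. (UNIV :: 'm set) \<subseteq> (\<Union>x\<in>k n. ball x (1 / real (Suc n)))"
    by metis
  define \<U> where "\<U> = (\<Union>n. (\<lambda>x. ball x (1 / real (Suc n))) ` k n)"
  have "countable \<U>" unfolding \<U>_def using k(1) by (auto intro: countable_finite)
  moreover have "\<U> \<noteq> {}" unfolding \<U>_def using k(2)[of 0] by fastforce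
  ultimately have rng: "range (from_nat_into \<U>) = \<U>" by (rule range_from_nat_into[rotated])
  define B where "B = from_nat_into \<U>"
  define c where "c t = (\<Sum>i. of_bool (t \<in> B i) / 3 ^ i :: real)" for t
  have geo: "summable (\<lambda>i. (1/3::real) ^ i)" by (rule summable_geometric) simp
  have sm: "summable (\<lambda>i. of_bool (a i) / 3 ^ i :: real)" for a :: "nat \<Rightarrow> bool"
    by (rule summable_comparison_test'[OF geo, of 0]) (auto simp: field_simps)
  show thesis
  proof
    show "0 \<le> c t" for t unfolding c_def by (intro suminf_nonneg sm) auto
    show "c t \<le> 2" for t
    proof -
      have "c t \<le> (\<Sum>i. (1/3) ^ i)" unfolding c_def
        by (intro suminf_le sm geo) (auto simp: field_simps)
      also have "\<dots> \<le> 2" by (subst suminf_geometric) auto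
      finally show ?thesis .
    qed
    fix e :: real assume "e > 0"
    \<comment> \<open>Two points in a common ball of radius below \<open>e / 2\<close> are less than
      \<open>e\<close> apart.\<close>
    obtain n where n: "1 / real (Suc n) < e / 2" using \<open>e > 0\<close>
      by (metis half_gt_zero nat_approx_posE)
    have "\<exists>i. B i = ball x (1 / real (Suc n))" if "x \<in> k n" for x
    proof -
      have "ball x (1 / real (Suc n)) \<in> \<U>" unfolding \<U>_def using that by (intro UN_I[of n] imageI) auto
      then have "ball x (1 / real (Suc n)) \<in> range B" using rng unfolding B_def by simp
      then show ?thesis by (metis rangeE)
    qed
    then obtain i where i: "\<And>x. x \<in> k n \<Longrightarrow> B (i x) = ball x (1 / real (Suc n))" by metis
    \<comment> \<open>All balls of the n-th cover are enumerated up to index \<open>N\<close>, so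
      agreement of the digits up to \<open>N\<close> decides membership in each of them.\<close>
    define N where "N = Max (insert 0 (i ` k n))"
    have N: "i x \<le> N" if "x \<in> k n" for x unfolding N_def using k(1) that by (intro Max_ge) auto
    show "\<exists>d>0. \<forall>s t. \<bar>c s - c t\<bar> < d \<longrightarrow> dist s t < e"
    proof (intro exI[of _ "1 / (2 * 3 ^ N)"] conjI allI impI)
      fix s t assume "\<bar>c s - c t\<bar> < 1 / (2 * 3 ^ N)"
      then have eq: "l \<le> N \<Longrightarrow> (s \<in> B l) = (t \<in> B l)" for l
        unfolding c_def by (rule ternary_digits_eq)
      obtain x where x: "x \<in> k n" "s \<in> ball x (1 / real (Suc n))" using k(2)[of n] by blast
      with eq[OF N[OF x(1)]] i[OF x(1)] have "t \<in> ball x (1 / real (Suc n))" by simp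
      with x(2) have "dist x s < 1 / real (Suc n)" "dist x t < 1 / real (Suc n)" by auto
      then show "dist s t < e" using n dist_triangle3[of s t x] by linarith
    qed simp
  qed
qed

text \<open>The assumption on \<open>c\<close> says that the inverse of \<open>c\<close> is
  uniformly continuous on the range. Such a map into a compact, hence complete, space extends
  continuously to the closure.\<close>

lemma inverse_of_coding_extends:
  fixes c :: "'m::metric_space \<Rightarrow> real"
  assumes "compact (UNIV :: 'm set)"
    and c: "\<And>e. e > 0 \<Longrightarrow> \<exists>d>0. \<forall>s t. \<bar>c s - c t\<bar> < d \<longrightarrow> dist s t < e"
  obtains g where "continuous_on (closure (range c)) g" "\<And>t. g (c t) = t"
proof -
  \<comment> \<open>The formula says that points whose codes tend to \<open>x\<close> tend to
    \<open>s\<close>. Compactness supplies \<open>s\<close> as a limit along a subsequence; uniform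
    continuity makes it the limit for all such points.\<close>
  have "\<exists>s. \<forall>e>0. \<exists>d>0. \<forall>t. \<bar>c t - x\<bar> < d \<longrightarrow> dist t s < e" if x: "x \<in> closure (range c)" for x
  proof -
    obtain v where "\<forall>n. v n \<in> range c" and v: "v \<longlonglongrightarrow> x"
      using x unfolding closure_sequential by blast
    then have "\<forall>n. \<exists>t. v n = c t" by blast
    then obtain u where u: "\<And>n. v n = c (u n)" by metis
    obtain s r where r: "strict_mono r" and s: "(u \<circ> r) \<longlonglongrightarrow> s"
      using assms(1) unfolding compact_def by (metis UNIV_I)
    have vr: "(v \<circ> r) \<longlonglongrightarrow> x" using v r by (rule LIMSEQ_subseq_LIMSEQ)
    show ?thesis
    proof (intro exI[of _ s] allI impI)
      fix e :: real assume "e > 0"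
      then obtain d where d: "d > 0" "\<And>s t. \<bar>c s - c t\<bar> < d \<Longrightarrow> dist s t < e/2"
        using c[of "e/2"] by auto
      have "\<forall>\<^sub>F n in sequentially. dist ((v \<circ> r) n) x < d/2 \<and> dist ((u \<circ> r) n) s < e/2"
        using tendstoD[OF vr, of "d/2"] tendstoD[OF s, of "e/2"] \<open>e > 0\<close> d(1) by (simp add: eventually_conj)
      then obtain n where n: "dist (v (r n)) x < d/2" "dist (u (r n)) s < e/2"
        using eventually_happens'[OF sequentially_bot] by fastforce
      have "dist t s < e" if "\<bar>c t - x\<bar> < d/2" for t
      proof -
        have "\<bar>c t - c (u (r n))\<bar> < d" using that n(1) unfolding u dist_real_def by linarith
        then have "dist t (u (r n)) < e/2" by (rule d(2))
        then show ?thesis using n(2) dist_triangle[of t s "u (r n)"] by linarith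
      qed
      then show "\<exists>d>0. \<forall>t. \<bar>c t - x\<bar> < d \<longrightarrow> dist t s < e" using d(1) by (intro exI[of _ "d/2"]) auto
    qed
  qed
  then obtain g where g: "\<And>x e. x \<in> closure (range c) \<Longrightarrow> e > 0 \<Longrightarrow> \<exists>d>0. \<forall>t. \<bar>c t - x\<bar> < d \<longrightarrow> dist t (g x) < e"
    by metis
  \<comment> \<open>Genuine points \<open>t\<close> with code near \<open>x\<close> and position
    near \<open>g x\<close> will serve as intermediaries when two values of \<open>g\<close> are
    compared.\<close>
  have near: "\<exists>t. \<bar>c t - x\<bar> < \<delta> \<and> dist t (g x) < e"
    if x: "x \<in> closure (range c)" and pos: "\<delta> > 0" "e > 0" for x \<delta> e
  proof -
    obtain d where d: "d > 0" "\<And>t. \<bar>c t - x\<bar> < d \<Longrightarrow> dist t (g x) < e" using g[OF x pos(2)] by auto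
    obtain t where "dist (c t) x < min d \<delta>"
      using x pos(1) d(1) unfolding closure_approachable by (metis min_less_iff_conj rangeE)
    then show ?thesis using d(2) by (auto simp: dist_real_def)
  qed
  show thesis
  proof
    show "g (c t) = t" for t
    proof (rule ccontr)
      assume "g (c t) \<noteq> t"
      then have "dist t (g (c t)) > 0" by simp
      moreover have "c t \<in> closure (range c)" by (rule subsetD[OF closure_subset rangeI])
      ultimately obtain d where "d > 0" "\<And>u. \<bar>c u - c t\<bar> < d \<Longrightarrow> dist u (g (c t)) < dist t (g (c t))"
        using g by blast
      from this(2)[of t] this(1) show False by simp
    qed
    show "continuous_on (closure (range c)) g"
      unfolding continuous_on_iff
    proof (intro ballI allI impI)
      fix x e assume x: "x \<in> closure (range c)" and "(e::real) > 0"
      \<comment> \<open>Thirds occur on both sides: the codes pass from \<open>c u\<close> through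
        \<open>y\<close> and \<open>x\<close> to \<open>c t\<close>, the points from
        \<open>g y\<close> through \<open>u\<close> and \<open>t\<close> to
        \<open>g x\<close>.\<close>
      obtain d where d: "d > 0" "\<And>s t. \<bar>c s - c t\<bar> < d \<Longrightarrow> dist s t < e/3"
        using c[of "e/3"] \<open>e > 0\<close> by auto
      have "dist (g y) (g x) < e" if y: "y \<in> closure (range c)" and "dist y x < d/3" for y
      proof -
        obtain t where t: "\<bar>c t - x\<bar> < d/3" "dist t (g x) < e/3" using near[OF x, of "d/3" "e/3"] d(1) \<open>e > 0\<close> by auto
        obtain u where u: "\<bar>c u - y\<bar> < d/3" "dist u (g y) < e/3" using near[OF y, of "d/3" "e/3"] d(1) \<open>e > 0\<close> by auto
        have "\<bar>c u - c t\<bar> < d" using t(1) u(1) \<open>dist y x < d/3\<close> unfolding dist_real_def by linarith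
        then have "dist u t < e/3" by (rule d(2))
        moreover have "dist (g y) (g x) \<le> dist u (g y) + dist u t + dist t (g x)"
          by (metis add.assoc add_left_mono dist_commute dist_triangle dist_triangle_le)
        ultimately show ?thesis using t u by linarith
      qed
      then show "\<exists>d>0. \<forall>x'\<in>closure (range c). dist x' x < d \<longrightarrow> dist (g x') (g x) < e"
        using d(1) by (intro exI[of _ "d/3"]) auto
    qed
  qed
qed

section \<open>Weak limits of empirical measures\<close>

text \<open>The empirical measures are moved to the real line by the code, where all of them live in
  a fixed bounded interval, so a subsequence converges weakly. The limit is carried by the closure
  \<open>K\<close> of the codes and is moved back by the extended inverse \<open>g\<close>.\<close>

lemma empirical_measures_convergent_subsequence:
  fixes x :: "nat \<Rightarrow> nat \<Rightarrow> 'm::metric_space"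
  assumes cpt: "compact (UNIV :: 'm set)" and N: "\<And>k. N k > 0"
  obtains r \<nu> where "strict_mono r" "prob_space \<nu>" "sets \<nu> = sets borel"
    "\<And>f :: 'm \<Rightarrow> real. continuous_on UNIV f \<Longrightarrow>
       (\<lambda>k. (\<Sum>i<N (r k). f (x (r k) i)) / real (N (r k))) \<longlonglongrightarrow> integral\<^sup>L \<nu> f"
proof -
  obtain c :: "'m \<Rightarrow> real" where c: "\<And>t. 0 \<le> c t" "\<And>t. c t \<le> 2"
    and cinv: "\<And>e. e > 0 \<Longrightarrow> \<exists>d>0. \<forall>s t. \<bar>c s - c t\<bar> < d \<longrightarrow> dist s t < e"
    using compact_real_coding[OF cpt] by blast
  define K where "K = closure (range c)"
  obtain g where gcont: "continuous_on K g" and gc: "\<And>t. g (c t) = t"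
    using inverse_of_coding_extends[OF cpt cinv] unfolding K_def by blast
  have cK: "c t \<in> K" for t unfolding K_def by (rule subsetD[OF closure_subset rangeI])
  have K: "closed K" "K \<noteq> {}" unfolding K_def by auto
  \<comment> \<open>The pushforward starts from the uniform measure on the indices, a discrete space
    on which every function is measurable, so a discontinuous \<open>c\<close> causes no
    difficulty.\<close>
  define L where "L k = distr (measure_pmf (pmf_of_set {..<N k})) borel (\<lambda>i. c (x k i))" for k
  have ne: "{..<N k} \<noteq> {}" for k using N[of k] by auto
  have Lrd: "real_distribution (L k)" for k
    unfolding L_def real_distribution_def real_distribution_axioms_def
    by (simp add: measure_pmf.prob_space_distr)
  have Lint: "integral\<^sup>L (L k) h = (\<Sum>i<N k. h (c (x k i))) / real (N k)"
    if "h \<in> borel_measurable borel" for h :: "real \<Rightarrow> real" and k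
    unfolding L_def by (subst integral_distr) (use that ne in \<open>auto simp: integral_pmf_of_set\<close>)
  have "tight L"
    unfolding tight_def
  proof (intro conjI allI impI Lrd)
    fix \<epsilon> :: real assume "\<epsilon> > 0"
    \<comment> \<open>Tightness uses intervals open on the left, and the code 0 may occur; hence a
      left end below 0.\<close>
    have "-1 < c t" "c t \<le> 2" for t using c[of t] by linarith+
    then have "measure (L k) {-1<..2} = 1" for k
      unfolding L_def by (subst measure_distr) (auto simp: vimage_def)
    then show "\<exists>a b. a < b \<and> (\<forall>n. 1 - \<epsilon> < measure (L n) {a<..b})"
      using \<open>\<epsilon> > 0\<close> by (intro exI[of _ "-1"] exI[of _ 2]) auto
  qed
  then obtain r \<rho> where r: "strict_mono r" and \<rho>: "real_distribution \<rho>"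
    and "weak_conv_m (L \<circ> id \<circ> r) \<rho>"
    using tight_imp_convergent_subsubsequence[of L id] by (auto simp: strict_mono_id)
  then have w: "weak_conv_m (\<lambda>k. L (r k)) \<rho>" by (simp add: o_def)
  interpret real_distribution \<rho> by fact
  have conv: "(\<lambda>k. (\<Sum>i<N (r k). h (c (x (r k) i))) / real (N (r k))) \<longlonglongrightarrow> integral\<^sup>L \<rho> h"
    if h: "continuous_on UNIV h" "\<And>y. \<bar>h y\<bar> \<le> B" for h :: "real \<Rightarrow> real" and B
  proof -
    have "(\<lambda>k. integral\<^sup>L (L (r k)) h) \<longlonglongrightarrow> integral\<^sup>L \<rho> h"
      by (rule weak_conv_imp_integral_bdd_continuous_conv[of "\<lambda>k. L (r k)", OF Lrd \<rho> w, of h B])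
        (use h in \<open>auto simp: continuous_on_eq_continuous_at\<close>)
    then show ?thesis using h(1) by (simp add: Lint borel_measurable_continuous_onI)
  qed
  \<comment> \<open>The distance to \<open>K\<close>, cut off at 1, is a bounded continuous test
    function whose zero set is \<open>K\<close>. Its empirical averages are all 0, hence so is its
    integral under the limit.\<close>
  have AEK: "AE y in \<rho>. y \<in> K"
  proof -
    let ?h = "\<lambda>y. min 1 (infdist y K)"
    have hc: "continuous_on UNIV ?h" by (intro continuous_intros)
    have "(\<lambda>k. 0) \<longlonglongrightarrow> integral\<^sup>L \<rho> ?h"
      using conv[OF hc, of 1] by (simp add: cK infdist_nonneg)
    then have "integral\<^sup>L \<rho> ?h = 0" by (simp add: LIMSEQ_const_iff)
    moreover have "integrable \<rho> ?h"
      by (rule integrable_const_bound[of _ 1])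
        (use borel_measurable_continuous_onI[OF hc] in \<open>auto simp: infdist_nonneg\<close>)
    ultimately have "AE y in \<rho>. ?h y = 0"
      by (subst (asm) integral_nonneg_eq_0_iff_AE) (auto simp: infdist_nonneg)
    then show ?thesis
      by (rule AE_mp) (auto simp: in_closed_iff_infdist_zero[OF K] min_def split: if_splits)
  qed
  \<comment> \<open>Off \<open>K\<close>, a null set of \<open>\<rho>\<close>, a constant value
    makes the map Borel on the whole line.\<close>
  define g' where "g' y = (if y \<in> K then g y else undefined)" for y
  have g'[measurable]: "g' \<in> borel_measurable borel"
    unfolding g'_def using K gcont by (intro borel_measurable_continuous_on_if) auto
  show thesis
  proof
    show "strict_mono r" by fact
    show "prob_space (distr \<rho> borel g')" by (intro prob_space_distr) auto
    show "sets (distr \<rho> borel g') = sets borel" by simp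
    fix f :: "'m \<Rightarrow> real" assume f: "continuous_on UNIV f"
    then have "bounded (range f)" using cpt by (intro compact_imp_bounded compact_continuous_image)
    then obtain B where B: "\<And>t. \<bar>f t\<bar> \<le> B" unfolding bounded_iff by auto
    have "0 \<le> B" using B[of undefined] by linarith
    have "continuous_on K (\<lambda>y. f (g y))"
      using f gcont by (intro continuous_on_compose2[OF f]) auto
    then obtain h where h: "continuous_on UNIV h" "\<And>y. y \<in> K \<Longrightarrow> h y = f (g y)" "\<And>y. \<bar>h y\<bar> \<le> B"
      \<comment> \<open>Weak convergence tests functions on the whole line, so
        \<open>f \<circ> g\<close> is extended from \<open>K\<close> without increasing its
        bound.\<close>
      using Tietze[of K "\<lambda>y. f (g y)" UNIV B] K B \<open>0 \<le> B\<close> by (auto simp: closed_closedin[symmetric])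
    have "(\<lambda>k. (\<Sum>i<N (r k). f (x (r k) i)) / real (N (r k))) \<longlonglongrightarrow> integral\<^sup>L \<rho> h"
      using conv[OF h(1,3)] by (simp add: h(2)[OF cK] gc)
    moreover have "integral\<^sup>L \<rho> h = integral\<^sup>L (distr \<rho> borel g') f"
    proof -
      note [measurable] = borel_measurable_continuous_onI[OF f] borel_measurable_continuous_onI[OF h(1)]
      have "integral\<^sup>L (distr \<rho> borel g') f = (\<integral>y. f (g' y) \<partial>\<rho>)" by (rule integral_distr) measurable
      also have "\<dots> = integral\<^sup>L \<rho> h"
      proof (rule integral_cong_AE)
        show "AE y in \<rho>. f (g' y) = h y" using AEK by eventually_elim (simp add: g'_def h(2))
      qed measurable
      finally show ?thesis by simp
    qed
    ultimately show "(\<lambda>k. (\<Sum>i<N (r k). f (x (r k) i)) / real (N (r k))) \<longlonglongrightarrow> integral\<^sup>L (distr \<rho> borel g') f"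
      by simp
  qed
qed

text \<open>Closed sets form an intersection-stable generator of the Borel sets. The indicator of a
  closed set is the pointwise limit of continuous functions with values between 0 and 1, and
  dominated convergence transfers the equality of integrals to it.\<close>

lemma borel_prob_eqI_continuous:
  fixes \<mu> \<nu> :: "'m::metric_space measure"
  assumes "prob_space \<mu>" "prob_space \<nu>" and sets: "sets \<mu> = sets borel" "sets \<nu> = sets borel"
    and eq: "\<And>f :: 'm \<Rightarrow> real. continuous_on UNIV f \<Longrightarrow> (\<And>t. 0 \<le> f t) \<Longrightarrow> (\<And>t. f t \<le> 1) \<Longrightarrow> integral\<^sup>L \<mu> f = integral\<^sup>L \<nu> f"
  shows "\<mu> = \<nu>"
proof (rule measure_eqI_generator_eq[where E = "Collect closed" and \<Omega> = UNIV and A = "\<lambda>_. UNIV"])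
  interpret \<mu>: prob_space \<mu> by fact
  interpret \<nu>: prob_space \<nu> by fact
  show "emeasure \<mu> C = emeasure \<nu> C" if "C \<in> Collect closed" for C
  proof (cases "C = {}")
    \<comment> \<open>The empty set is separated because \<open>infdist\<close> to it is 0 by
      convention, which would make every \<open>f n\<close> constantly 1.\<close>
    case False
    have C: "closed C" "C \<in> sets borel" using that by auto
    define f where "f n t = max 0 (1 - real n * infdist t C)" for n t
    have fc: "continuous_on UNIV (f n)" for n unfolding f_def by (intro continuous_intros)
    have f01: "0 \<le> f n t" "f n t \<le> 1" for n t unfolding f_def by (auto simp: infdist_nonneg)
    have flim: "(\<lambda>n. f n t) \<longlonglongrightarrow> indicator C t" for t
    proof (cases "t \<in> C")
      case True
      then show ?thesis by (simp add: f_def)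
    next
      case F: False
      then have "infdist t C > 0"
        using in_closed_iff_infdist_zero[OF C(1) False, of t] infdist_nonneg[of t C] by linarith
      then obtain m where m: "1 < real m * infdist t C" using reals_Archimedean3 by blast
      have "f n t = 0" if "n \<ge> m" for n
      proof -
        have "real m * infdist t C \<le> real n * infdist t C" using that by (intro mult_right_mono) (auto simp: infdist_nonneg)
        then show ?thesis using m unfolding f_def by simp
      qed
      then have "\<forall>\<^sub>F n in sequentially. f n t = indicator C t" using F
        by (auto intro!: eventually_sequentiallyI[of m])
      then show ?thesis by (rule tendsto_eventually)
    qed
    have lim: "(\<lambda>n. integral\<^sup>L M (f n)) \<longlonglongrightarrow> measure M C" if "prob_space M" "sets M = sets borel" for M
    proof -
      interpret M: prob_space M by fact
      have fm: "f n \<in> borel_measurable M" for n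
        using borel_measurable_continuous_onI[OF fc, of n] that(2) measurable_cong_sets by blast
      have "(\<lambda>n. integral\<^sup>L M (f n)) \<longlonglongrightarrow> integral\<^sup>L M (indicator C)"
        by (rule integral_dominated_convergence[where w = "\<lambda>_. 1"])
          (use fm flim f01 that(2) C(2) in \<open>auto simp: abs_le_iff intro: order_trans[OF _ f01(1)]\<close>)
      then show ?thesis using C(2) that(2) by simp
    qed
    have "measure \<mu> C = measure \<nu> C"
      using lim[OF \<mu>.prob_space_axioms sets(1)] lim[OF \<nu>.prob_space_axioms sets(2)] eq[OF fc f01]
      by (metis (no_types, lifting) LIMSEQ_unique ext)
    then show ?thesis by (simp add: \<mu>.emeasure_eq_measure \<nu>.emeasure_eq_measure)
  qed auto
  have "sets (borel :: 'm measure) = sigma_sets UNIV (Collect closed)" by (subst borel_eq_closed) simp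
  then show "sets \<mu> = sigma_sets UNIV (Collect closed)" "sets \<nu> = sigma_sets UNIV (Collect closed)"
    using sets by simp_all
  show "Int_stable (Collect closed :: 'm set set)" by (auto simp: Int_stable_def)
  show "emeasure \<mu> UNIV \<noteq> \<infinity>" by (simp add: \<mu>.emeasure_eq_measure)
qed auto

section \<open>Uniform ergodic averages under unique ergodicity\<close>

lemma uniquely_ergodic_unique:
  assumes "uniquely_ergodic \<tau>" "invariant_borel_prob \<tau> \<mu>" "invariant_borel_prob \<tau> \<nu>"
  shows "\<nu> = \<mu>"
  using assms unfolding uniquely_ergodic_def by metis

text \<open>If uniformity failed, there would be arbitrarily long orbit segments with bad averages.
  A weak limit of their empirical measures is invariant, hence equal to \<open>\<mu>\<close>, and
  this contradicts the bad averages of \<open>f\<close>.\<close>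

theorem uniquely_ergodic_uniform_averages:
  fixes \<tau> :: "'m::metric_space \<Rightarrow> 'm" and f :: "'m \<Rightarrow> real"
  assumes cpt: "compact (UNIV :: 'm set)" and ue: "uniquely_ergodic \<tau>" and mu: "invariant_borel_prob \<tau> \<mu>"
    and f: "continuous_on UNIV f" and "e > 0"
  shows "\<forall>\<^sub>F n in sequentially. \<forall>t. \<bar>(\<Sum>i<n. f ((\<tau> ^^ i) t)) / real n - integral\<^sup>L \<mu> f\<bar> < e"
proof (rule ccontr)
  assume "\<not> ?thesis"
  then have "\<forall>k. \<exists>n\<ge>Suc k. \<exists>t. \<not> \<bar>(\<Sum>i<n. f ((\<tau> ^^ i) t)) / real n - integral\<^sup>L \<mu> f\<bar> < e"
    unfolding eventually_sequentially by blast
  then obtain N t where N: "\<And>k. N k \<ge> Suc k"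
    and bad: "\<And>k. \<not> \<bar>(\<Sum>i<N k. f ((\<tau> ^^ i) (t k))) / real (N k) - integral\<^sup>L \<mu> f\<bar> < e"
    by metis
  have N0: "N k > 0" for k using N[of k] by simp
  obtain r \<nu> where r: "strict_mono r" and \<nu>: "prob_space \<nu>" "sets \<nu> = sets borel"
    and lim: "\<And>h :: 'm \<Rightarrow> real. continuous_on UNIV h \<Longrightarrow>
       (\<lambda>k. (\<Sum>i<N (r k). h ((\<tau> ^^ i) (t (r k)))) / real (N (r k))) \<longlonglongrightarrow> integral\<^sup>L \<nu> h"
    by (rule empirical_measures_convergent_subsequence[OF cpt, of N, where x = "\<lambda>k i. (\<tau> ^^ i) (t k)", OF N0])
      (rule that)
  have \<tau>: "continuous_on UNIV \<tau>" using ue unfolding uniquely_ergodic_def by simp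
  have \<tau>m: "\<tau> \<in> measurable \<nu> borel"
    using borel_measurable_continuous_onI[OF \<tau>] \<nu>(2) measurable_cong_sets by blast
  interpret \<nu>: prob_space \<nu> by fact
  have "distr \<nu> borel \<tau> = \<nu>"
  proof (rule borel_prob_eqI_continuous)
    fix h :: "'m \<Rightarrow> real" assume h: "continuous_on UNIV h" "\<And>t. 0 \<le> h t" "\<And>t. h t \<le> 1"
    have h\<tau>: "continuous_on UNIV (\<lambda>x. h (\<tau> x))" using \<tau> by (intro continuous_on_compose2[OF h(1)]) auto
    \<comment> \<open>Shifting an orbit segment by one step changes only its two end terms, and both
      lie between 0 and 1.\<close>
    have "\<bar>(\<Sum>i<n. h (\<tau> ((\<tau> ^^ i) s))) / real n - (\<Sum>i<n. h ((\<tau> ^^ i) s)) / real n\<bar> \<le> 1 / real n" for n s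
    proof -
      have "(\<Sum>i<n. h (\<tau> ((\<tau> ^^ i) s))) - (\<Sum>i<n. h ((\<tau> ^^ i) s)) = h ((\<tau> ^^ n) s) - h s"
        using sum_lessThan_telescope[of "\<lambda>i. h ((\<tau> ^^ i) s)" n] by (simp add: sum_subtractf)
      then show ?thesis using h(2,3)[of "(\<tau> ^^ n) s"] h(2,3)[of s]
        by (auto simp: diff_divide_distrib[symmetric] intro!: divide_right_mono)
    qed
    note b = this
    have "(\<lambda>k. 1 / real (N (r k))) \<longlonglongrightarrow> 0"
    proof (rule tendsto_sandwich[of "\<lambda>_. 0" _ _ "\<lambda>k. 1 / real (Suc k)"])
      \<comment> \<open>The segments still grow along the subsequence, so the error from the end
        terms vanishes and the limit is invariant.\<close>
      have "Suc k \<le> N (r k)" for k using N[of "r k"] seq_suble[OF r, of k] by linarith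
      then show "\<forall>\<^sub>F k in sequentially. 1 / real (N (r k)) \<le> 1 / real (Suc k)"
        using N0 by (intro always_eventually allI divide_left_mono) (auto simp del: of_nat_Suc)
      show "(\<lambda>k. 1 / real (Suc k)) \<longlonglongrightarrow> 0" by (rule lim_1_over_n[THEN LIMSEQ_Suc])
    qed auto
    then have "(\<lambda>k. (\<Sum>i<N (r k). h (\<tau> ((\<tau> ^^ i) (t (r k))))) / real (N (r k))
        - (\<Sum>i<N (r k). h ((\<tau> ^^ i) (t (r k)))) / real (N (r k))) \<longlonglongrightarrow> 0"
      by (rule Lim_null_comparison[rotated]) (use b in auto)
    moreover have "(\<lambda>k. (\<Sum>i<N (r k). h (\<tau> ((\<tau> ^^ i) (t (r k))))) / real (N (r k))
        - (\<Sum>i<N (r k). h ((\<tau> ^^ i) (t (r k)))) / real (N (r k)))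
        \<longlonglongrightarrow> (\<integral>x. h (\<tau> x) \<partial>\<nu>) - integral\<^sup>L \<nu> h"
      by (intro tendsto_diff lim h\<tau> h(1))
    ultimately have "(\<integral>x. h (\<tau> x) \<partial>\<nu>) = integral\<^sup>L \<nu> h"
      using LIMSEQ_unique by fastforce
    then show "integral\<^sup>L (distr \<nu> borel \<tau>) h = integral\<^sup>L \<nu> h"
      by (subst integral_distr[OF \<tau>m]) (auto intro: borel_measurable_continuous_onI h(1))
  qed (use \<nu> \<tau>m in \<open>auto intro: \<nu>.prob_space_distr\<close>)
  then have "invariant_borel_prob \<tau> \<nu>" unfolding invariant_borel_prob_def using \<nu> by simp
  then have "\<nu> = \<mu>" using uniquely_ergodic_unique[OF ue mu] by simp
  then have "(\<lambda>k. (\<Sum>i<N (r k). f ((\<tau> ^^ i) (t (r k)))) / real (N (r k))) \<longlonglongrightarrow> integral\<^sup>L \<mu> f"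
    using lim[OF f] by simp
  then have "\<forall>\<^sub>F k in sequentially. \<bar>(\<Sum>i<N (r k). f ((\<tau> ^^ i) (t (r k)))) / real (N (r k)) - integral\<^sup>L \<mu> f\<bar> < e"
    using \<open>e > 0\<close> by (auto dest: tendstoD simp: dist_real_def)
  then show False using bad eventually_happens'[OF sequentially_bot] by fastforce
qed

section \<open>Inequalities for p-th powers and approximation by simple functions\<close>

lemma convex_on_abs_powr:
  assumes "1 \<le> p"
  shows "convex_on UNIV (\<lambda>x::real. \<bar>x\<bar> powr p)"
proof (rule convex_onI)
  fix t x y :: real assume t: "0 < t" "t < 1"
  \<comment> \<open>When one of the two arguments is 0, convexity reduces to this inequality for the
    remaining weight.\<close>
  have le: "s powr p \<le> s" if "0 < s" "s < 1" for s :: real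
    using powr_mono'[of 1 p s] assms that by simp
  have "\<bar>(1 - t) *\<^sub>R x + t *\<^sub>R y\<bar> powr p \<le> ((1 - t) * \<bar>x\<bar> + t * \<bar>y\<bar>) powr p"
    using t assms by (intro powr_mono2) (auto intro!: order_trans[OF abs_triangle_ineq] simp: abs_mult)
  also have "\<dots> \<le> (1 - t) * \<bar>x\<bar> powr p + t * \<bar>y\<bar> powr p"
  proof (cases "x = 0 \<or> y = 0")
    case True
    then show ?thesis
    proof
      assume "x = 0"
      then show ?thesis using t le[of t] by (simp add: powr_mult mult_right_mono)
    next
      assume "y = 0"
      then show ?thesis using t le[of "1 - t"] by (simp add: powr_mult mult_right_mono)
    qed
  next
    case False
    then show ?thesis
      using convex_onD[OF powr_convex[OF assms], of t "\<bar>x\<bar>" "\<bar>y\<bar>"] t by simp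
  qed
  finally show "\<bar>(1 - t) *\<^sub>R x + t *\<^sub>R y\<bar> powr p \<le> (1 - t) * \<bar>x\<bar> powr p + t * \<bar>y\<bar> powr p" .
qed simp

text \<open>Jensen's inequality with equal weights; for \<open>n = 0\<close> both sides are
  0.\<close>

lemma abs_mean_powr_le:
  fixes a :: "nat \<Rightarrow> real"
  assumes "1 \<le> p"
  shows "\<bar>(\<Sum>i<n. a i) / real n\<bar> powr p \<le> (\<Sum>i<n. \<bar>a i\<bar> powr p) / real n"
proof (cases "n = 0")
  case False
  then have ne: "{..<n} \<noteq> {}" by auto
  have "\<bar>\<Sum>i<n. (1 / real n) *\<^sub>R a i\<bar> powr p \<le> (\<Sum>i<n. (1 / real n) * \<bar>a i\<bar> powr p)"
    by (rule convex_on_sum[OF _ ne convex_on_abs_powr[OF assms]]) (use False in auto)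
  then show ?thesis by (simp add: sum_divide_distrib)
qed simp

text \<open>The sum is at most four times the largest absolute value, whose p-th power is one of the
  terms on the right. This crude substitute for the triangle inequality avoids p-th roots; shorter
  sums are padded with zeros.\<close>

lemma abs_add4_powr_le:
  fixes a b c d p :: real
  assumes "0 \<le> p"
  shows "\<bar>a + b + c + d\<bar> powr p \<le> 4 powr p * (\<bar>a\<bar> powr p + \<bar>b\<bar> powr p + \<bar>c\<bar> powr p + \<bar>d\<bar> powr p)"
proof -
  define m where "m = max (max \<bar>a\<bar> \<bar>b\<bar>) (max \<bar>c\<bar> \<bar>d\<bar>)"
  have "\<bar>a + b + c + d\<bar> \<le> 4 * m" unfolding m_def by linarith
  then have "\<bar>a + b + c + d\<bar> powr p \<le> (4 * m) powr p" using assms by (intro powr_mono2) auto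
  also have "\<dots> = 4 powr p * m powr p" unfolding m_def by (intro powr_mult)
  also have "m powr p \<le> \<bar>a\<bar> powr p + \<bar>b\<bar> powr p + \<bar>c\<bar> powr p + \<bar>d\<bar> powr p"
    unfolding m_def max_def using powr_ge_zero[of "\<bar>a\<bar>" p] powr_ge_zero[of "\<bar>b\<bar>" p]
      powr_ge_zero[of "\<bar>c\<bar>" p] powr_ge_zero[of "\<bar>d\<bar>" p] by (simp del: powr_ge_zero)
  finally show ?thesis by simp
qed

lemma integrable_abs_powr_diff:
  fixes f g :: "'a \<Rightarrow> real"
  assumes p: "0 \<le> p" and [measurable]: "f \<in> borel_measurable M" "g \<in> borel_measurable M"
    and "integrable M (\<lambda>x. \<bar>f x\<bar> powr p)" "integrable M (\<lambda>x. \<bar>g x\<bar> powr p)"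
  shows "integrable M (\<lambda>x. \<bar>f x - g x\<bar> powr p)"
proof (rule Bochner_Integration.integrable_bound)
  show "integrable M (\<lambda>x. 4 powr p * (\<bar>f x\<bar> powr p + \<bar>g x\<bar> powr p))"
    using assms by (intro integrable_mult_right Bochner_Integration.integrable_add)
  show "AE x in M. norm (\<bar>f x - g x\<bar> powr p) \<le> norm (4 powr p * (\<bar>f x\<bar> powr p + \<bar>g x\<bar> powr p))"
    using abs_add4_powr_le[OF p, of "f _" "- g _" 0 0] by (intro AE_I2) auto
qed measurable

context prob_space
begin

lemma integrable_of_abs_powr:
  fixes X :: "'a \<Rightarrow> real"
  assumes p: "1 \<le> p" and X[measurable]: "X \<in> borel_measurable M" and "integrable M (\<lambda>x. \<bar>X x\<bar> powr p)"
  shows "integrable M X"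
proof (rule Bochner_Integration.integrable_bound)
  show "integrable M (\<lambda>x. 1 + \<bar>X x\<bar> powr p)" using assms by simp
  have "y \<le> 1 + y powr p" if "0 \<le> y" for y :: real
    using that powr_mono[of 1 p y] p by (cases "y \<le> 1") (auto intro: add_increasing2)
  then show "AE x in M. norm (X x) \<le> norm (1 + \<bar>X x\<bar> powr p)" by (intro AE_I2) auto
qed measurable

lemma abs_expectation_powr_le:
  fixes X :: "'a \<Rightarrow> real"
  assumes p: "1 \<le> p" and X: "X \<in> borel_measurable M" and i: "integrable M (\<lambda>x. \<bar>X x\<bar> powr p)"
  shows "\<bar>expectation X\<bar> powr p \<le> expectation (\<lambda>x. \<bar>X x\<bar> powr p)"
  by (rule jensens_inequality[OF integrable_of_abs_powr[OF assms], of UNIV])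
    (use i convex_on_abs_powr[OF p] in auto)

lemma simple_function_bounded:
  fixes s :: "'a \<Rightarrow> real"
  assumes "simple_function M s"
  obtains C where "\<And>x. x \<in> space M \<Longrightarrow> \<bar>s x\<bar> \<le> C"
proof -
  have "bounded (s ` space M)" using simple_functionD(1)[OF assms] by (rule finite_imp_bounded)
  then show thesis using that unfolding bounded_iff by auto
qed

lemma integrable_simple_powr:
  fixes s :: "'a \<Rightarrow> real"
  assumes s: "simple_function M s" and "0 \<le> p"
  shows "integrable M (\<lambda>x. \<bar>s x\<bar> powr p)"
proof -
  obtain C where C: "\<And>x. x \<in> space M \<Longrightarrow> \<bar>s x\<bar> \<le> C" using simple_function_bounded[OF s] by blast
  note [measurable] = borel_measurable_simple_function[OF s]
  show ?thesis
    by (rule integrable_const_bound[of _ "C powr p"]) (use C assms in \<open>auto intro!: powr_mono2\<close>)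
qed

text \<open>Simple functions \<open>s i\<close> converge to \<open>h\<close> pointwise with absolute
  value at most twice that of \<open>h\<close>. The error is then at most three times the absolute
  value of \<open>h\<close>, and dominated convergence applies.\<close>

lemma Lp_simple_approximation:
  fixes h :: "'a \<Rightarrow> real"
  assumes p: "0 < p" and h[measurable]: "h \<in> borel_measurable M" and i: "integrable M (\<lambda>x. \<bar>h x\<bar> powr p)"
    and "e > 0"
  shows "\<exists>s. simple_function M s \<and> expectation (\<lambda>x. \<bar>h x - s x\<bar> powr p) < e"
proof -
  obtain s where s: "\<And>i. simple_function M (s i)"
    and lim: "\<And>x. x \<in> space M \<Longrightarrow> (\<lambda>i. s i x) \<longlonglongrightarrow> h x"
    and bd: "\<And>i x. x \<in> space M \<Longrightarrow> \<bar>s i x\<bar> \<le> 2 * \<bar>h x\<bar>"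
  proof -
    obtain s where "\<forall>i. simple_function M (s i)" "\<forall>x\<in>space M. (\<lambda>i. s i x) \<longlonglongrightarrow> h x"
      "\<forall>i. \<forall>x\<in>space M. dist (s i x) 0 \<le> 2 * dist (h x) 0"
      using borel_measurable_implies_sequence_metric[OF h, of 0] by blast
    then show thesis by (intro that[of s]) auto
  qed
  note [measurable] = borel_measurable_simple_function[OF s]
  have "(\<lambda>i. expectation (\<lambda>x. \<bar>h x - s i x\<bar> powr p)) \<longlonglongrightarrow> expectation (\<lambda>x. 0)"
  proof (rule integral_dominated_convergence[where w = "\<lambda>x. 3 powr p * \<bar>h x\<bar> powr p"])
    show "AE x in M. (\<lambda>i. \<bar>h x - s i x\<bar> powr p) \<longlonglongrightarrow> 0"
    proof (intro AE_I2)
      fix x assume "x \<in> space M"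
      then have "(\<lambda>i. \<bar>h x - s i x\<bar>) \<longlonglongrightarrow> \<bar>h x - h x\<bar>" by (intro tendsto_intros lim)
      then have "(\<lambda>i. \<bar>h x - s i x\<bar>) \<longlonglongrightarrow> 0" by simp
      from tendsto_powr2[OF this tendsto_const[of p]] p
      show "(\<lambda>i. \<bar>h x - s i x\<bar> powr p) \<longlonglongrightarrow> 0" by simp
    qed
    show "AE x in M. norm (\<bar>h x - s i x\<bar> powr p) \<le> 3 powr p * \<bar>h x\<bar> powr p" for i
    proof (intro AE_I2)
      fix x assume "x \<in> space M"
      then have "\<bar>h x - s i x\<bar> \<le> 3 * \<bar>h x\<bar>" using bd[of x i] by linarith
      then have "\<bar>h x - s i x\<bar> powr p \<le> (3 * \<bar>h x\<bar>) powr p" using p by (intro powr_mono2) auto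
      then show "norm (\<bar>h x - s i x\<bar> powr p) \<le> 3 powr p * \<bar>h x\<bar> powr p" by (simp add: powr_mult)
    qed
  qed (use i in auto)
  then have "\<forall>\<^sub>F i in sequentially. expectation (\<lambda>x. \<bar>h x - s i x\<bar> powr p) < e"
    using \<open>e > 0\<close> by (auto dest: order_tendstoD(2))
  then show ?thesis using s eventually_happens'[OF sequentially_bot] by fastforce
qed

end

section \<open>Mixing actions and averages of centred simple functions\<close>

lemma pres_group_comp:
  assumes "pres_group P \<theta>"
  shows "\<theta> k \<in> measurable P P" "distr P P (\<theta> k) = P" "\<theta> k (\<theta> l w) = \<theta> (k + l) w"
  using assms unfolding pres_group_def by (auto simp: fun_eq_iff)

lemma pres_group_integral:
  fixes f :: "'w \<Rightarrow> real"
  assumes "pres_group P \<theta>" "f \<in> borel_measurable P"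
  shows "(\<integral>w. f (\<theta> k w) \<partial>P) = integral\<^sup>L P f"
  using integral_distr[OF pres_group_comp(1)[OF assms(1)] assms(2), of k] pres_group_comp(2)[OF assms(1), of k] by simp

lemma pres_group_integrable:
  fixes f :: "'w \<Rightarrow> real"
  assumes "pres_group P \<theta>" "integrable P f"
  shows "integrable P (\<lambda>w. f (\<theta> k w))"
  using integrable_distr[OF pres_group_comp(1)[OF assms(1), of k], of f] pres_group_comp(2)[OF assms(1), of k]
    assms(2) by simp

text \<open>The correlation is a finite linear combination of probabilities that a level set of
  \<open>u\<close> meets a shifted level set of \<open>v\<close>, and mixing applies to each term.
  The filter \<open>filtercomap maxnorm at_top\<close> expresses that the norm of \<open>k\<close>
  tends to infinity.\<close>

lemma strongly_mixing_simple_functions: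
  fixes u v :: "'w \<Rightarrow> real" and \<theta> :: "int ^ 'd \<Rightarrow> 'w \<Rightarrow> 'w"
  assumes "prob_space P" and grp: "pres_group P \<theta>" and mix: "strongly_mixing P \<theta>"
    and u: "simple_function P u" and v: "simple_function P v"
  shows "((\<lambda>k. \<integral>w. u w * v (\<theta> k w) \<partial>P) \<longlongrightarrow> integral\<^sup>L P u * integral\<^sup>L P v) (filtercomap maxnorm at_top)"
proof -
  interpret prob_space P by fact
  define U where "U y = u -` {y} \<inter> space P" for y
  define V where "V y = v -` {y} \<inter> space P" for y
  have UV[measurable]: "U y \<in> sets P" "V y \<in> sets P" for y
    unfolding U_def V_def using simple_functionD(2)[OF u] simple_functionD(2)[OF v] by auto
  let ?I = "u ` space P" and ?J = "v ` space P"
  have fin: "finite ?I" "finite ?J" using simple_functionD(1)[OF u] simple_functionD(1)[OF v] by auto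
  have ue: "u w = (\<Sum>y\<in>?I. y * indicator (U y) w)" if "w \<in> space P" for w
  proof -
    have "(\<Sum>y\<in>?I. y * indicator (U y) w) = (\<Sum>y\<in>?I. if y = u w then y else 0)"
      by (intro sum.cong) (auto simp: U_def indicator_def that)
    then show ?thesis using fin that by simp
  qed
  have ve: "v w = (\<Sum>y\<in>?J. y * indicator (V y) w)" if "w \<in> space P" for w
  proof -
    have "(\<Sum>y\<in>?J. y * indicator (V y) w) = (\<Sum>y\<in>?J. if y = v w then y else 0)"
      by (intro sum.cong) (auto simp: V_def indicator_def that)
    then show ?thesis using fin that by simp
  qed
  note [measurable] = pres_group_comp(1)[OF grp]
  have ind: "integrable P (\<lambda>w. c * indicator A w :: real)" if "A \<in> sets P" for A c
    using that by (intro integrable_mult_right integrable_real_indicator) (auto simp: emeasure_eq_measure)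
  have isum: "(\<integral>w. (\<Sum>y\<in>I. f y * indicator (A y) w) \<partial>P) = (\<Sum>y\<in>I. f y * measure P (A y))"
    if "\<And>y. A y \<in> sets P" for I :: "'i set" and f :: "'i \<Rightarrow> real" and A
    by (subst Bochner_Integration.integral_sum[OF ind]) (use that in \<open>auto simp: sets.Int_space_eq2\<close>)
  have iu: "integral\<^sup>L P u = (\<Sum>y\<in>?I. y * measure P (U y))"
    by (subst Bochner_Integration.integral_cong[OF refl ue]) (auto simp: isum)
  have iv: "integral\<^sup>L P v = (\<Sum>y\<in>?J. y * measure P (V y))"
    by (subst Bochner_Integration.integral_cong[OF refl ve]) (auto simp: isum)
  have iuv: "(\<integral>w. u w * v (\<theta> k w) \<partial>P) =
      (\<Sum>y\<in>?I. \<Sum>z\<in>?J. y * z * measure P (U y \<inter> (\<theta> k -` V z \<inter> space P)))" for k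
  proof -
    have \<theta>: "\<theta> k w \<in> space P" if "w \<in> space P" for w
      using pres_group_comp(1)[OF grp, of k] that by (rule measurable_space)
    have m[measurable]: "\<theta> k -` V z \<inter> space P \<in> sets P" for z by measurable
    have "u w * v (\<theta> k w) = (\<Sum>y\<in>?I. \<Sum>z\<in>?J. y * z * indicator (U y \<inter> (\<theta> k -` V z \<inter> space P)) w)"
      if "w \<in> space P" for w
      unfolding ue[OF that] ve[OF \<theta>[OF that]] sum_product
      by (intro sum.cong refl) (use that in \<open>auto simp: indicator_def\<close>)
    then have "(\<integral>w. u w * v (\<theta> k w) \<partial>P) =
      (\<integral>w. (\<Sum>y\<in>?I. \<Sum>z\<in>?J. y * z * indicator (U y \<inter> (\<theta> k -` V z \<inter> space P)) w) \<partial>P)"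
      by (intro Bochner_Integration.integral_cong) auto
    then show ?thesis by (simp add: sum.cartesian_product isum sets.Int case_prod_unfold)
  qed
  have "((\<lambda>k. \<Sum>y\<in>?I. \<Sum>z\<in>?J. y * z * measure P (U y \<inter> (\<theta> k -` V z \<inter> space P))) \<longlongrightarrow>
      (\<Sum>y\<in>?I. \<Sum>z\<in>?J. y * z * (measure P (U y) * measure P (V z)))) (filtercomap maxnorm at_top)"
    using mix UV unfolding strongly_mixing_def by (intro tendsto_sum tendsto_mult tendsto_const) auto
  moreover have "(\<Sum>y\<in>?I. \<Sum>z\<in>?J. y * z * (measure P (U y) * measure P (V z))) = integral\<^sup>L P u * integral\<^sup>L P v"
    unfolding iu iv sum_product by (simp add: mult_ac)
  ultimately show ?thesis unfolding iuv by simp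
qed

text \<open>Second moments: the pairs whose displacement is at most \<open>m\<close> are rare, all other pairs are nearly uncorrelated.\<close>

lemma mixing_averages_L2:
  fixes \<theta> :: "int ^ 'd \<Rightarrow> 'w \<Rightarrow> 'w" and k :: "'t \<Rightarrow> nat \<Rightarrow> int ^ 'd"
  assumes P: "prob_space P" and grp: "pres_group P \<theta>" and mix: "strongly_mixing P \<theta>"
    and rare: "\<And>(m::nat) e. e > 0 \<Longrightarrow> \<forall>\<^sub>F n in sequentially. \<forall>t.
      real (card {(i, j). i < n \<and> j < n \<and> maxnorm (k t i - k t j) \<le> int m}) \<le> e * (real n)\<^sup>2"
    and S: "finite S" "\<And>s. s \<in> S \<Longrightarrow> simple_function P s" "\<And>s. s \<in> S \<Longrightarrow> integral\<^sup>L P s = 0"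
    and C: "\<And>s w. s \<in> S \<Longrightarrow> w \<in> space P \<Longrightarrow> \<bar>s w\<bar> \<le> C" and "e > 0"
  shows "\<forall>\<^sub>F n in sequentially. \<forall>t s. (\<forall>i. s i \<in> S) \<longrightarrow>
    (\<integral>w. ((\<Sum>i<n. s i (\<theta> (k t i) w)) / real n)\<^sup>2 \<partial>P) \<le> e"
proof -
  interpret prob_space P by fact
  note \<theta>m[measurable] = pres_group_comp(1)[OF grp]
  have sm: "s \<in> borel_measurable P" if "s \<in> S" for s
    using S(2)[OF that] by (rule borel_measurable_simple_function)
  define \<rho> where "\<rho> u v l = (\<integral>w. u w * v (\<theta> l w) \<partial>P)" for u v :: "'w \<Rightarrow> real" and l
  have bd: "\<bar>u (\<theta> l w) * v (\<theta> l' w)\<bar> \<le> C\<^sup>2" if "u \<in> S" "v \<in> S" "w \<in> space P" for u v l l' w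
  proof -
    have "\<bar>u (\<theta> l w)\<bar> \<le> C" "\<bar>v (\<theta> l' w)\<bar> \<le> C"
      using that measurable_space[OF \<theta>m] by (auto intro!: C)
    then show ?thesis unfolding abs_mult power2_eq_square by (intro mult_mono) (auto intro: order_trans[OF abs_ge_zero])
  qed
  have int: "integrable P (\<lambda>w. u (\<theta> l w) * v (\<theta> l' w))" if "u \<in> S" "v \<in> S" for u v l l'
  proof -
    note [measurable] = sm[OF that(1)] sm[OF that(2)]
    show ?thesis using bd[OF that] by (intro integrable_const_bound[of _ "C\<^sup>2"]) auto
  qed
  \<comment> \<open>Undoing the shift by \<open>l'\<close> preserves the integral, so a correlation
    depends only on the displacement.\<close>
  have cov: "(\<integral>w. u (\<theta> l w) * v (\<theta> l' w) \<partial>P) = \<rho> v u (l - l')" if "u \<in> S" "v \<in> S" for u v l l'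
  proof -
    note [measurable] = sm[OF that(1)] sm[OF that(2)]
    have "(\<integral>w. u (\<theta> l w) * v (\<theta> l' w) \<partial>P) = (\<integral>w. (\<lambda>w. v w * u (\<theta> (l - l') w)) (\<theta> l' w) \<partial>P)"
      by (simp add: pres_group_comp(3)[OF grp] mult.commute)
    also have "\<dots> = \<rho> v u (l - l')" unfolding \<rho>_def by (rule pres_group_integral[OF grp]) measurable
    finally show ?thesis .
  qed
  have \<rho>bd: "\<bar>\<rho> v u (l - l')\<bar> \<le> C\<^sup>2" if "u \<in> S" "v \<in> S" for u v l l'
  proof -
    have "\<bar>\<rho> v u (l - l')\<bar> \<le> (\<integral>w. \<bar>u (\<theta> l w) * v (\<theta> l' w)\<bar> \<partial>P)"
      unfolding cov[OF that, symmetric] by (rule integral_abs_bound)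
    also have "\<dots> \<le> (\<integral>w. C\<^sup>2 \<partial>P)" using bd[OF that] int[OF that] by (intro integral_mono) auto
    finally show ?thesis by (simp add: prob_space)
  qed
  have "\<forall>\<^sub>F l in filtercomap maxnorm at_top. \<bar>\<rho> u v l\<bar> < e/2" if "u \<in> S" "v \<in> S" for u v
    using tendstoD[OF strongly_mixing_simple_functions[OF P grp mix S(2)[OF that(1)] S(2)[OF that(2)]], of "e/2"] \<open>e > 0\<close>
    unfolding \<rho>_def S(3)[OF that(1)] by (simp add: dist_real_def)
  \<comment> \<open>The limits are 0 because the functions are centred; finiteness of
    \<open>S\<close> yields one threshold \<open>M\<close> for all pairs.\<close>
  then have "\<forall>\<^sub>F l in filtercomap (maxnorm :: int ^ 'd \<Rightarrow> int) at_top. \<forall>u\<in>S. \<forall>v\<in>S. \<bar>\<rho> u v l\<bar> < e/2"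
    using S(1) by (intro eventually_ball_finite ballI) auto
  then obtain M where M: "\<And>l u v. maxnorm l \<ge> M \<Longrightarrow> u \<in> S \<Longrightarrow> v \<in> S \<Longrightarrow> \<bar>\<rho> u v l\<bar> < e/2"
    unfolding eventually_filtercomap_at_top_linorder by blast
  \<comment> \<open>The threshold may be negative; in every case \<open>M \<le> int m\<close>, so a
    displacement above \<open>m\<close> is also above \<open>M\<close>.\<close>
  define m where "m = nat M"
  \<comment> \<open>Each close pair contributes at most \<open>C\<^sup>2\<close>, so this density of
    close pairs costs at most \<open>e / 2\<close>; adding 1 keeps the denominator positive when
    \<open>C = 0\<close>.\<close>
  have "e / (2 * (C\<^sup>2 + 1)) > 0" using \<open>e > 0\<close> by (simp add: add_nonneg_pos)
  from rare[OF this, of m] eventually_gt_at_top[of "0::nat"] show ?thesis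
  proof eventually_elim
    case (elim n)
    show ?case
    proof (intro allI impI)
      fix t and s :: "nat \<Rightarrow> 'w \<Rightarrow> real" assume s: "\<forall>i. s i \<in> S"
      define B where "B = {(i, j). i < n \<and> j < n \<and> maxnorm (k t i - k t j) \<le> int m}"
      have B: "B \<subseteq> {..<n} \<times> {..<n}" unfolding B_def by auto
      have "(\<integral>w. ((\<Sum>i<n. s i (\<theta> (k t i) w)) / real n)\<^sup>2 \<partial>P)
          = (\<integral>w. (\<Sum>(i,j)\<in>{..<n} \<times> {..<n}. s i (\<theta> (k t i) w) * s j (\<theta> (k t j) w)) / (real n)\<^sup>2 \<partial>P)"
        by (simp add: power_divide power2_eq_square sum_product sum.cartesian_product)
      also have "\<dots> = (\<Sum>(i,j)\<in>{..<n} \<times> {..<n}. \<rho> (s j) (s i) (k t i - k t j)) / (real n)\<^sup>2"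
        using s by (simp add: case_prod_unfold int cov)
      \<comment> \<open>Pairs outside \<open>B\<close> have small correlation by mixing; those
        inside get only the trivial bound.\<close>
      also have "\<dots> \<le> (\<Sum>ij\<in>{..<n} \<times> {..<n}. e/2 + C\<^sup>2 * indicator B ij) / (real n)\<^sup>2"
      proof (intro divide_right_mono sum_mono)
        fix ij assume ij: "ij \<in> {..<n} \<times> {..<n}"
        obtain i j where [simp]: "ij = (i, j)" by (cases ij)
        show "(case ij of (i, j) \<Rightarrow> \<rho> (s j) (s i) (k t i - k t j)) \<le> e/2 + C\<^sup>2 * indicator B ij"
        proof (cases "ij \<in> B")
          case True
          then show ?thesis using \<rho>bd[of "s i" "s j" "k t i" "k t j"] s \<open>e > 0\<close> by simp
        next
          case False
          then have "maxnorm (k t i - k t j) \<ge> M" using ij unfolding B_def m_def by (auto split: if_splits)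
          from M[OF this, of "s j" "s i"] s False show ?thesis by simp
        qed
      qed simp
      also have "(\<Sum>ij\<in>{..<n} \<times> {..<n}. e/2 + C\<^sup>2 * indicator B ij) = (real n)\<^sup>2 * (e/2) + C\<^sup>2 * real (card B)"
      proof -
        have "(\<Sum>ij\<in>{..<n} \<times> {..<n}. indicator B ij :: real) = real (card B)"
          using sum.mono_neutral_cong_right[of "{..<n} \<times> {..<n}" B "indicator B" "\<lambda>_. 1::real"] B by auto
        then show ?thesis by (simp add: sum.distrib sum_distrib_left[symmetric] power2_eq_square)
      qed
      also have "(\<dots>) / (real n)\<^sup>2 \<le> ((real n)\<^sup>2 * (e/2) + (real n)\<^sup>2 * (e/2)) / (real n)\<^sup>2"
      proof (intro divide_right_mono add_left_mono)
        have "C\<^sup>2 * real (card B) \<le> (C\<^sup>2 + 1) * (e / (2 * (C\<^sup>2 + 1)) * (real n)\<^sup>2)"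
          using elim(1) unfolding B_def by (intro mult_mono) auto
        also have "\<dots> = (real n)\<^sup>2 * (e/2)"
        proof -
          have "C\<^sup>2 + 1 \<noteq> 0" using zero_le_power2[of C] by linarith
          then show ?thesis by (simp add: field_simps)
        qed
        finally show "C\<^sup>2 * real (card B) \<le> (real n)\<^sup>2 * (e/2)" .
      qed simp
      also have "\<dots> = e" using elim(2) by simp
      finally show "(\<integral>w. ((\<Sum>i<n. s i (\<theta> (k t i) w)) / real n)\<^sup>2 \<partial>P) \<le> e" .
    qed
  qed
qed

text \<open>The average \<open>X\<close> is bounded by \<open>C\<close>. Where it is at most
  \<open>\<delta>\<close> in absolute value, its p-th power is at most \<open>e / 2\<close>;
  elsewhere the p-th power is at most \<open>C powr p\<close> times the square of
  \<open>X / \<delta>\<close>, as in Chebyshev's inequality. The second moment therefore controls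
  every positive p.\<close>

lemma mixing_averages_Lp:
  fixes \<theta> :: "int ^ 'd \<Rightarrow> 'w \<Rightarrow> 'w" and k :: "'t \<Rightarrow> nat \<Rightarrow> int ^ 'd"
  assumes P: "prob_space P" and grp: "pres_group P \<theta>" and mix: "strongly_mixing P \<theta>"
    and rare: "\<And>(m::nat) e. e > 0 \<Longrightarrow> \<forall>\<^sub>F n in sequentially. \<forall>t.
      real (card {(i, j). i < n \<and> j < n \<and> maxnorm (k t i - k t j) \<le> int m}) \<le> e * (real n)\<^sup>2"
    and S: "finite S" "\<And>s. s \<in> S \<Longrightarrow> simple_function P s" "\<And>s. s \<in> S \<Longrightarrow> integral\<^sup>L P s = 0"
    and "e > 0" and p: "0 < p"
  shows "\<forall>\<^sub>F n in sequentially. \<forall>t s. (\<forall>i. s i \<in> S) \<longrightarrow>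
    (\<integral>w. \<bar>(\<Sum>i<n. s i (\<theta> (k t i) w)) / real n\<bar> powr p \<partial>P) \<le> e"
proof -
  interpret prob_space P by fact
  note \<theta>m[measurable] = pres_group_comp(1)[OF grp]
  have "\<exists>C. \<forall>w\<in>space P. \<bar>s w\<bar> \<le> C" if "s \<in> S" for s
    using simple_function_bounded[OF S(2)[OF that]] by metis
  then obtain c where c: "\<And>s w. s \<in> S \<Longrightarrow> w \<in> space P \<Longrightarrow> \<bar>s w\<bar> \<le> c s" by metis
  \<comment> \<open>Inserting 0 covers empty \<open>S\<close> and makes the bound
    nonnegative.\<close>
  define C where "C = Max (insert 0 (c ` S))"
  have C0: "0 \<le> C" unfolding C_def using S(1) by (intro Max_ge) auto
  have C: "\<bar>s w\<bar> \<le> C" if "s \<in> S" "w \<in> space P" for s w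
    using S(1) that unfolding C_def by (intro order_trans[OF c[OF that]] Max_ge) auto
  define \<delta> where "\<delta> = (e/2) powr (1/p)"
  have \<delta>: "\<delta> > 0" "\<delta> powr p = e/2" unfolding \<delta>_def using \<open>e > 0\<close> p by (auto simp: powr_powr)
  define K where "K = C powr p / \<delta>\<^sup>2"
  have K: "K \<ge> 0" unfolding K_def by simp
  \<comment> \<open>The second moment is multiplied by \<open>K\<close> below, so this tolerance
    leaves at most \<open>e / 2\<close>; \<open>K\<close> may be 0, hence
    \<open>K + 1\<close>.\<close>
  have "e / (2 * (K + 1)) > 0" using \<open>e > 0\<close> K by simp
  then have "\<forall>\<^sub>F n in sequentially. \<forall>t s. (\<forall>i. s i \<in> S) \<longrightarrow>
    (\<integral>w. ((\<Sum>i<n. s i (\<theta> (k t i) w)) / real n)\<^sup>2 \<partial>P) \<le> e / (2 * (K + 1))"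
    by (intro mixing_averages_L2[of P \<theta> k S C] P grp mix rare S C)
  from this eventually_gt_at_top[of "0::nat"]
  show ?thesis
  proof eventually_elim
    case (elim n)
    show ?case
    proof (intro allI impI)
      fix t and s :: "nat \<Rightarrow> 'w \<Rightarrow> real" assume s: "\<forall>i. s i \<in> S"
      define X where "X w = (\<Sum>i<n. s i (\<theta> (k t i) w)) / real n" for w
      have sm[measurable]: "s i \<in> borel_measurable P" for i
        using S(2) s by (auto intro: borel_measurable_simple_function)
      have Xm[measurable]: "X \<in> borel_measurable P" unfolding X_def by measurable
      have XC: "\<bar>X w\<bar> \<le> C" if "w \<in> space P" for w
      proof -
        have "\<bar>\<Sum>i<n. s i (\<theta> (k t i) w)\<bar> \<le> (\<Sum>i<n. C)"
          by (rule order_trans[OF sum_abs sum_mono])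
            (use s that measurable_space[OF \<theta>m] in \<open>auto intro!: C\<close>)
        then show ?thesis unfolding X_def using elim(2) by (simp add: field_simps)
      qed
      have X2: "integrable P (\<lambda>w. (X w)\<^sup>2)"
        by (rule integrable_const_bound[of _ "C\<^sup>2"]) (use XC C0 in \<open>auto simp: abs_le_square_iff[symmetric]\<close>)
      have "(\<integral>w. \<bar>X w\<bar> powr p \<partial>P) \<le> (\<integral>w. e/2 + K * (X w)\<^sup>2 \<partial>P)"
      proof (rule integral_mono')
        show "integrable P (\<lambda>w. e/2 + K * (X w)\<^sup>2)" using X2 by simp
        show "0 \<le> e/2 + K * (X w)\<^sup>2" for w using K \<open>e > 0\<close> by simp
        show "\<bar>X w\<bar> powr p \<le> e/2 + K * (X w)\<^sup>2" if w: "w \<in> space P" for w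
        proof (cases "\<bar>X w\<bar> \<le> \<delta>")
          case True
          then have "\<bar>X w\<bar> powr p \<le> e/2" using p unfolding \<delta>(2)[symmetric] by (intro powr_mono2) auto
          then show ?thesis using K by (simp add: add_increasing2)
        next
          case False
          then have "\<delta>\<^sup>2 \<le> (X w)\<^sup>2" using \<delta>(1) by (simp add: abs_le_square_iff[symmetric])
          then have "1 \<le> (X w)\<^sup>2 / \<delta>\<^sup>2" using \<delta>(1) by simp
          moreover have "\<bar>X w\<bar> powr p \<le> C powr p" using XC[OF w] p by (intro powr_mono2) auto
          ultimately have "\<bar>X w\<bar> powr p * 1 \<le> C powr p * ((X w)\<^sup>2 / \<delta>\<^sup>2)" by (intro mult_mono) auto
          then show ?thesis using \<open>e > 0\<close> unfolding K_def by simp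
        qed
      qed
      also have "\<dots> = e/2 + K * (\<integral>w. (X w)\<^sup>2 \<partial>P)" using X2 by (simp add: prob_space)
      also have "K * (\<integral>w. (X w)\<^sup>2 \<partial>P) \<le> (K + 1) * (e / (2 * (K + 1)))"
        using elim(1) s K unfolding X_def by (intro mult_mono) auto
      also have "e/2 + (K + 1) * (e / (2 * (K + 1))) = e" using K by (simp add: field_simps)
      finally show "(\<integral>w. \<bar>(\<Sum>i<n. s i (\<theta> (k t i) w)) / real n\<bar> powr p \<partial>P) \<le> e" unfolding X_def by simp
    qed
  qed
qed

section \<open>Counting close pairs of displacements\<close>

text \<open>Orbit sums run over the indices from 0 to \<open>n - 1\<close>, while the assumption
  counts indices from 1 to \<open>n\<close>. Only pairs with a zero index are missed, at most
  \<open>2 * n\<close> of them, which is negligible against the square of \<open>n\<close>.\<close>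

lemma rare_returns:
  fixes \<tau> :: "'m \<Rightarrow> 'm" and \<kappa> :: "'m \<Rightarrow> int ^ 'd"
  assumes kcond: "((\<lambda>n. (SUP t. real (card {(i, j). 1 \<le> i \<and> i \<le> n \<and> 1 \<le> j \<and> j \<le> n \<and>
                    maxnorm (kappa_sum \<tau> \<kappa> i t - kappa_sum \<tau> \<kappa> j t) \<le> int m}))
                  / (real n)\<^sup>2) \<longlonglongrightarrow> 0)" and "e > 0"
  shows "\<forall>\<^sub>F n in sequentially. \<forall>t.
    real (card {(i, j). i < n \<and> j < n \<and> maxnorm (kappa_sum \<tau> \<kappa> i t - kappa_sum \<tau> \<kappa> j t) \<le> int m}) \<le> e * (real n)\<^sup>2"
proof -
  define A where "A n t = {(i, j). 1 \<le> i \<and> i \<le> n \<and> 1 \<le> j \<and> j \<le> n \<and>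
                    maxnorm (kappa_sum \<tau> \<kappa> i t - kappa_sum \<tau> \<kappa> j t) \<le> int m}" for n t
  have A: "A n t \<subseteq> {..n} \<times> {..n}" for n t unfolding A_def by auto
  then have Afin: "finite (A n t)" for n t by (rule finite_subset) auto
  have "card (A n t) \<le> card ({..n} \<times> {..n})" for n t by (rule card_mono[OF _ A]) auto
  \<comment> \<open>A real supremum dominates its members only over a bounded family; here the
    trivial bound counts all pairs.\<close>
  then have bdd: "bdd_above (range (\<lambda>t. real (card (A n t))))" for n
    by (intro bdd_aboveI2[of _ _ "real (card ({..n} \<times> {..n}))"] of_nat_mono)
  have "\<forall>\<^sub>F n in sequentially. (SUP t. real (card (A n t))) / (real n)\<^sup>2 < e/2"
    using order_tendstoD(2)[OF kcond, of "e/2"] \<open>e > 0\<close> unfolding A_def by simp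
  \<comment> \<open>From this point on the \<open>2 * n\<close> extra pairs fit into half of the
    allowance.\<close>
  moreover have "\<forall>\<^sub>F n in sequentially. 4 / e \<le> real n"
    using filterlim_real_sequentially unfolding filterlim_at_top by blast
  ultimately show ?thesis using eventually_gt_at_top[of 0]
  proof eventually_elim
    case (elim n)
    show ?case
    proof
      fix t
      let ?B = "{(i, j). i < n \<and> j < n \<and> maxnorm (kappa_sum \<tau> \<kappa> i t - kappa_sum \<tau> \<kappa> j t) \<le> int m}"
      have "?B \<subseteq> A n t \<union> (({0} \<times> {..<n}) \<union> ({..<n} \<times> {0}))" unfolding A_def by auto
      then have "card ?B \<le> card (A n t \<union> (({0} \<times> {..<n}) \<union> ({..<n} \<times> {0})))"
        using Afin by (intro card_mono) auto
      also have "\<dots> \<le> card (A n t) + (card ({0::nat} \<times> {..<n}) + card ({..<n} \<times> {0::nat}))"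
        by (intro order_trans[OF card_Un_le] add_left_mono card_Un_le)
      finally have "real (card ?B) \<le> real (card (A n t)) + 2 * real n" by (simp add: card_cartesian_product)
      also have "real (card (A n t)) \<le> (SUP t. real (card (A n t)))" by (rule cSUP_upper[OF _ bdd]) simp
      also have "\<dots> \<le> e/2 * (real n)\<^sup>2" using elim(1,3) by (simp add: field_simps)
      also have "2 * real n \<le> e/2 * (real n)\<^sup>2"
      proof -
        have "4 \<le> e * real n" using elim(2) \<open>e > 0\<close> by (simp add: field_simps)
        then have "4 * real n \<le> e * real n * real n" by (rule mult_right_mono) simp
        then show ?thesis by (simp add: power2_eq_square)
      qed
      finally show "real (card ?B) \<le> e * (real n)\<^sup>2" by simp
    qed
  qed
qed

section \<open>Uniform convergence in p-th mean along orbits\<close>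

lemma abs_less_of_powr_less:
  fixes x y p :: real
  assumes "\<bar>x\<bar> powr p < y powr p" "0 \<le> p" "0 \<le> y"
  shows "\<bar>x\<bar> < y"
  using assms powr_mono2[of p y "\<bar>x\<bar>"] by (meson linorder_not_le)

text \<open>Compactness and uniform continuity reduce the family \<open>H\<close> to finitely many
  base points up to a small error. Each \<open>\<sigma> t\<close> is a simple approximation at a
  base point near \<open>t\<close>, so only finitely many functions occur.\<close>

lemma (in prob_space) finite_simple_Lp_net:
  fixes H :: "'m::metric_space \<Rightarrow> 'a \<Rightarrow> real"
  assumes cpt: "compact (UNIV :: 'm set)" and p: "1 \<le> p"
    and Hm: "\<And>t. H t \<in> borel_measurable M" and Hi: "\<And>t. integrable M (\<lambda>w. \<bar>H t w\<bar> powr p)"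
    and Hc: "\<And>e. e > 0 \<Longrightarrow> \<exists>d>0. \<forall>s t. dist s t < d \<longrightarrow> (\<integral>w. \<bar>H s w - H t w\<bar> powr p \<partial>M) < e"
    and "e > 0"
  obtains \<sigma> :: "'m::metric_space \<Rightarrow> 'a \<Rightarrow> real" where "finite (range \<sigma>)" "\<And>t. simple_function M (\<sigma> t)"
    "\<And>t. (\<integral>w. \<bar>H t w - \<sigma> t w\<bar> powr p \<partial>M) \<le> e"
proof -
  \<comment> \<open>Two errors below \<open>e'\<close>, moving to the base point and approximating
    there, are combined at the price of the factor \<open>4 powr p\<close>.\<close>
  define e' where "e' = e / (2 * 4 powr p)"
  have e': "e' > 0" unfolding e'_def using \<open>e > 0\<close> by simp
  obtain d where d: "d > 0" "\<And>s t. dist s t < d \<Longrightarrow> (\<integral>w. \<bar>H s w - H t w\<bar> powr p \<partial>M) < e'"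
    using Hc[OF e'] by blast
  obtain K where K: "finite K" "(UNIV :: 'm set) \<subseteq> (\<Union>x\<in>K. ball x d)"
    using cpt d(1) unfolding compact_eq_totally_bounded by blast
  have "\<exists>x\<in>K. dist t x < d" for t
  proof -
    have "t \<in> (\<Union>x\<in>K. ball x d)" using K(2) by (rule subsetD) simp
    then show ?thesis by (auto simp: dist_commute)
  qed
  then obtain x where x: "\<And>t. x t \<in> K" "\<And>t. dist t (x t) < d" by metis
  obtain s where s: "\<And>y. simple_function M (s y)" "\<And>y. (\<integral>w. \<bar>H y w - s y w\<bar> powr p \<partial>M) < e'"
  proof -
    have "0 < p" using p by simp
    from Lp_simple_approximation[OF this Hm Hi e'] show ?thesis using that by metis
  qed
  show thesis
  proof (rule that[of "\<lambda>t. s (x t)"])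
    have "range (\<lambda>t. s (x t)) \<subseteq> s ` K" using x(1) by auto
    then show "finite (range (\<lambda>t. s (x t)))" using K(1) by (meson finite_imageI finite_subset)
    show "simple_function M (s (x t))" for t by (rule s(1))
    fix t
    note [measurable] = Hm borel_measurable_simple_function[OF s(1)]
    have i1: "integrable M (\<lambda>w. \<bar>H t w - H (x t) w\<bar> powr p)"
      using p by (intro integrable_abs_powr_diff Hm Hi) auto
    have i2: "integrable M (\<lambda>w. \<bar>H (x t) w - s (x t) w\<bar> powr p)"
      using p by (intro integrable_abs_powr_diff Hm Hi integrable_simple_powr s(1)) auto
    have "(\<integral>w. \<bar>H t w - s (x t) w\<bar> powr p \<partial>M)
      \<le> (\<integral>w. 4 powr p * (\<bar>H t w - H (x t) w\<bar> powr p + \<bar>H (x t) w - s (x t) w\<bar> powr p) \<partial>M)"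
    proof (rule integral_mono')
      show "integrable M (\<lambda>w. 4 powr p * (\<bar>H t w - H (x t) w\<bar> powr p + \<bar>H (x t) w - s (x t) w\<bar> powr p))"
        using i1 i2 by simp
      show "\<bar>H t w - s (x t) w\<bar> powr p \<le> 4 powr p * (\<bar>H t w - H (x t) w\<bar> powr p + \<bar>H (x t) w - s (x t) w\<bar> powr p)" for w
        using abs_add4_powr_le[of p "H t w - H (x t) w" "H (x t) w - s (x t) w" 0 0] p by simp
    qed simp
    also have "\<dots> = 4 powr p * ((\<integral>w. \<bar>H t w - H (x t) w\<bar> powr p \<partial>M) + (\<integral>w. \<bar>H (x t) w - s (x t) w\<bar> powr p \<partial>M))"
      using i1 i2 by simp
    also have "\<dots> \<le> 4 powr p * (e' + e')"
      using d(2)[OF x(2), of t] s(2)[of "x t"] by (intro mult_left_mono add_mono) auto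
    also have "\<dots> = e" unfolding e'_def by simp
    finally show "(\<integral>w. \<bar>H t w - s (x t) w\<bar> powr p \<partial>M) \<le> e" .
  qed
qed

text \<open>The deviation splits into four averages: the error \<open>H - \<sigma>\<close>, the
  centred simple functions \<open>\<sigma>0\<close>, the difference \<open>c - a\<close> of the
  means, and the deviation of the orbit average of \<open>a\<close>. Approximation controls the
  first and third, mixing the second, unique ergodicity the fourth.\<close>

theorem uniform_Lp_ergodic:
  fixes \<tau> :: "'m::metric_space \<Rightarrow> 'm" and \<theta> :: "int ^ 'd \<Rightarrow> 'w \<Rightarrow> 'w"
    and k :: "'m \<Rightarrow> nat \<Rightarrow> int ^ 'd" and H :: "'m \<Rightarrow> 'w \<Rightarrow> real"
  assumes cpt: "compact (UNIV :: 'm set)" and ue: "uniquely_ergodic \<tau>" and mu: "invariant_borel_prob \<tau> \<mu>"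
    and P: "prob_space P" and grp: "pres_group P \<theta>" and mix: "strongly_mixing P \<theta>"
    and rare: "\<And>(m::nat) e. e > 0 \<Longrightarrow> \<forall>\<^sub>F n in sequentially. \<forall>t.
      real (card {(i, j). i < n \<and> j < n \<and> maxnorm (k t i - k t j) \<le> int m}) \<le> e * (real n)\<^sup>2"
    and p: "1 \<le> p"
    and Hm: "\<And>t. H t \<in> borel_measurable P" and Hi: "\<And>t. integrable P (\<lambda>w. \<bar>H t w\<bar> powr p)"
    and Hc: "\<And>e. e > 0 \<Longrightarrow> \<exists>d>0. \<forall>s t. dist s t < d \<longrightarrow> (\<integral>w. \<bar>H s w - H t w\<bar> powr p \<partial>P) < e"
    and "e > 0"
  shows "\<forall>\<^sub>F n in sequentially. \<forall>t. (\<integral>w. \<bar>(\<Sum>i<n. H ((\<tau> ^^ i) t) (\<theta> (k t i) w)) / real n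
    - (\<integral>x. integral\<^sup>L P (H x) \<partial>\<mu>)\<bar> powr p \<partial>P) \<le> e"
proof -
  interpret prob_space P by fact
  note [measurable] = pres_group_comp(1)[OF grp]
  define a where "a t = integral\<^sup>L P (H t)" for t
  \<comment> \<open>By Jensen, the p-th power of a difference of means is at most the p-th moment of
    the difference of the functions.\<close>
  have acont: "continuous_on UNIV a"
    unfolding continuous_on_iff
  proof (intro ballI allI impI)
    fix t and \<epsilon> :: real assume "\<epsilon> > 0"
    then obtain d where d: "d > 0" "\<And>s t. dist s t < d \<Longrightarrow> (\<integral>w. \<bar>H s w - H t w\<bar> powr p \<partial>P) < \<epsilon> powr p"
      using Hc[of "\<epsilon> powr p"] by auto
    have "dist (a s) (a t) < \<epsilon>" if "dist s t < d" for s
    proof -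
      have "a s - a t = (\<integral>w. H s w - H t w \<partial>P)" unfolding a_def
        using integrable_of_abs_powr[OF p Hm Hi] by simp
      also have "\<bar>\<dots>\<bar> powr p \<le> (\<integral>w. \<bar>H s w - H t w\<bar> powr p \<partial>P)"
        using p by (intro abs_expectation_powr_le integrable_abs_powr_diff Hm Hi borel_measurable_diff) auto
      also have "\<dots> < \<epsilon> powr p" using d(2)[OF that] .
      finally show ?thesis unfolding dist_real_def using p \<open>\<epsilon> > 0\<close> by (intro abs_less_of_powr_less) auto
    qed
    then show "\<exists>d>0. \<forall>x'\<in>UNIV. dist x' t < d \<longrightarrow> dist (a x') (a t) < \<epsilon>" using d(1) by auto
  qed
  \<comment> \<open>Four contributions of at most \<open>e'\<close> each, times the factor
    \<open>4 powr p\<close>.\<close>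
  define e' where "e' = e / (4 * 4 powr p)"
  have e': "e' > 0" unfolding e'_def using \<open>e > 0\<close> by simp
  obtain \<sigma> where \<sigma>: "finite (range \<sigma>)" "\<And>t. simple_function P (\<sigma> t)"
    "\<And>t. (\<integral>w. \<bar>H t w - \<sigma> t w\<bar> powr p \<partial>P) \<le> e'"
    using finite_simple_Lp_net[OF cpt p Hm Hi Hc e'] by blast
  define c where "c t = integral\<^sup>L P (\<sigma> t)" for t
  define \<sigma>0 where "\<sigma>0 t w = \<sigma> t w - c t" for t w
  note \<sigma>m[measurable] = Hm borel_measurable_simple_function[OF \<sigma>(2)]
  have \<sigma>i: "integrable P (\<lambda>w. \<bar>\<sigma> t w\<bar> powr p)" for t using p by (intro integrable_simple_powr \<sigma>(2)) auto
  have \<sigma>1: "integrable P (\<sigma> t)" for t by (rule integrable_of_abs_powr[OF p _ \<sigma>i]) measurable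
  have Hi1: "integrable P (H t)" for t by (rule integrable_of_abs_powr[OF p Hm Hi])
  have dif: "integrable P (\<lambda>w. \<bar>H t w - \<sigma> t w\<bar> powr p)" for t
    using p by (intro integrable_abs_powr_diff Hi \<sigma>i) auto
  have s0: "simple_function P (\<sigma>0 t)" for t
    unfolding \<sigma>0_def by (intro simple_function_diff \<sigma>(2) simple_function_const)
  have s0i: "integrable P (\<lambda>w. \<bar>\<sigma>0 t w\<bar> powr p)" for t using p by (intro integrable_simple_powr s0) auto
  note [measurable] = borel_measurable_simple_function[OF s0]
  have s0m: "integral\<^sup>L P (\<sigma>0 t) = 0" for t unfolding \<sigma>0_def c_def using \<sigma>1 by (simp add: prob_space)
  \<comment> \<open>Centring depends only on the function and not on \<open>t\<close>, so the family
    remains finite.\<close>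
  have "range \<sigma>0 = (\<lambda>s w. s w - integral\<^sup>L P s) ` range \<sigma>" unfolding \<sigma>0_def c_def by auto
  then have fin0: "finite (range \<sigma>0)" using \<sigma>(1) by simp
  have ca: "\<bar>c t - a t\<bar> powr p \<le> e'" for t
  proof -
    have "\<bar>c t - a t\<bar> = \<bar>\<integral>w. H t w - \<sigma> t w \<partial>P\<bar>" unfolding a_def c_def using \<sigma>1 Hi1 by simp
    also have "\<dots> powr p \<le> (\<integral>w. \<bar>H t w - \<sigma> t w\<bar> powr p \<partial>P)"
      by (rule abs_expectation_powr_le[OF p _ dif]) measurable
    also have "\<dots> \<le> e'" by (rule \<sigma>(3))
    finally show ?thesis .
  qed
  \<comment> \<open>The bound is uniform over all sequences from the finite family, so the sequence
    may later be the one read off the orbit of \<open>t\<close>.\<close>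
  have L: "\<forall>\<^sub>F n in sequentially. \<forall>t s. (\<forall>i. s i \<in> range \<sigma>0) \<longrightarrow>
    (\<integral>w. \<bar>(\<Sum>i<n. s i (\<theta> (k t i) w)) / real n\<bar> powr p \<partial>P) \<le> e'"
    by (rule mixing_averages_Lp[OF P grp mix rare fin0 _ _ e']) (use s0 s0m p in auto)
  have "e' powr (1/p) > 0" using e' by simp
  from uniquely_ergodic_uniform_averages[OF cpt ue mu acont this] L eventually_gt_at_top[of "0::nat"]
  show ?thesis
  proof eventually_elim
    case (elim n)
    show ?case
    proof
      fix t
      define y where "y i = (\<tau> ^^ i) t" for i
      define l where "l i = k t i" for i
      let ?I = "integral\<^sup>L \<mu> a"
      define X2 where "X2 w = (\<Sum>i<n. \<sigma>0 (y i) (\<theta> (l i) w)) / real n" for w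
      define X4 where "X4 = (\<Sum>i<n. a (y i)) / real n - ?I"
      \<comment> \<open>The mean of p-th powers dominates the p-th power of the mean error, and
        invariance of \<open>P\<close> removes the shifts from its integral.\<close>
      define Y1 where "Y1 w = (\<Sum>i<n. \<bar>H (y i) (\<theta> (l i) w) - \<sigma> (y i) (\<theta> (l i) w)\<bar> powr p) / real n" for w
      have n: "real n > 0" using elim(3) by simp
      have mean_le: "(\<Sum>i<n. b i) / real n \<le> e'" if "\<And>i. b i \<le> e'" for b :: "nat \<Rightarrow> real"
      proof -
        have "(\<Sum>i<n. b i) \<le> (\<Sum>i<n. e')" by (intro sum_mono that)
        then show ?thesis using n by (simp add: field_simps)
      qed
      have di: "integrable P (\<lambda>w. \<bar>H (y i) (\<theta> (l i) w) - \<sigma> (y i) (\<theta> (l i) w)\<bar> powr p)" for i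
        by (rule pres_group_integrable[OF grp dif])
      have Y1i: "integrable P Y1" unfolding Y1_def
        by (intro integrable_divide Bochner_Integration.integrable_sum di)
      have "integral\<^sup>L P Y1 = (\<Sum>i<n. \<integral>w. \<bar>H (y i) (\<theta> (l i) w) - \<sigma> (y i) (\<theta> (l i) w)\<bar> powr p \<partial>P) / real n"
        unfolding Y1_def
        by (simp add: Bochner_Integration.integral_sum[OF di])
      also have "\<dots> = (\<Sum>i<n. \<integral>w. \<bar>H (y i) w - \<sigma> (y i) w\<bar> powr p \<partial>P) / real n"
        by (simp add: pres_group_integral[OF grp borel_measurable_integrable[OF dif]])
      also have "\<dots> \<le> e'" by (intro mean_le \<sigma>(3))
      finally have Y1: "integral\<^sup>L P Y1 \<le> e'" .
      have X2i: "integrable P (\<lambda>w. \<bar>X2 w\<bar> powr p)"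
      proof (rule Bochner_Integration.integrable_bound)
        show "integrable P (\<lambda>w. (\<Sum>i<n. \<bar>\<sigma>0 (y i) (\<theta> (l i) w)\<bar> powr p) / real n)"
          by (intro integrable_divide Bochner_Integration.integrable_sum pres_group_integrable[OF grp s0i])
        show "AE w in P. norm (\<bar>X2 w\<bar> powr p) \<le> norm ((\<Sum>i<n. \<bar>\<sigma>0 (y i) (\<theta> (l i) w)\<bar> powr p) / real n)"
          unfolding X2_def real_norm_def
          by (intro AE_I2 order_trans[OF _ abs_ge_self]) (simp only: abs_of_nonneg[OF powr_ge_zero] abs_mean_powr_le[OF p])
        show "(\<lambda>w. \<bar>X2 w\<bar> powr p) \<in> borel_measurable P" unfolding X2_def by measurable
      qed
      have X2: "(\<integral>w. \<bar>X2 w\<bar> powr p \<partial>P) \<le> e'"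
        using elim(2)[rule_format, of "\<lambda>i. \<sigma>0 (y i)" t] unfolding X2_def l_def by simp
      have X4: "\<bar>X4\<bar> powr p \<le> e'"
      proof -
        have "\<bar>X4\<bar> powr p \<le> (e' powr (1/p)) powr p"
          using elim(1) p unfolding X4_def y_def by (intro powr_mono2) (auto intro: less_imp_le)
        then show ?thesis using p e' by (simp add: powr_powr)
      qed
      have pointwise: "\<bar>(\<Sum>i<n. H (y i) (\<theta> (l i) w)) / real n - ?I\<bar> powr p
          \<le> 4 powr p * (Y1 w + \<bar>X2 w\<bar> powr p + e' + e')" for w
      proof -
        let ?X1 = "(\<Sum>i<n. H (y i) (\<theta> (l i) w) - \<sigma> (y i) (\<theta> (l i) w)) / real n"
        let ?X3 = "(\<Sum>i<n. c (y i) - a (y i)) / real n"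
        \<comment> \<open>Since \<open>\<sigma>0\<close> is \<open>\<sigma>\<close> minus
          \<open>c\<close>, the averages of \<open>\<sigma>\<close>, \<open>c\<close> and
          \<open>a\<close> cancel between consecutive pieces.\<close>
        have "(\<Sum>i<n. H (y i) (\<theta> (l i) w)) / real n - ?I = ?X1 + X2 w + ?X3 + X4"
          unfolding X2_def X4_def \<sigma>0_def by (simp add: sum_subtractf diff_divide_distrib)
        then have "\<bar>(\<Sum>i<n. H (y i) (\<theta> (l i) w)) / real n - ?I\<bar> powr p
          \<le> 4 powr p * (\<bar>?X1\<bar> powr p + \<bar>X2 w\<bar> powr p + \<bar>?X3\<bar> powr p + \<bar>X4\<bar> powr p)"
          using abs_add4_powr_le[of p ?X1 "X2 w" ?X3 X4] p by (simp only:)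
        also have "\<dots> \<le> 4 powr p * (Y1 w + \<bar>X2 w\<bar> powr p + e' + e')"
        proof (intro mult_left_mono add_mono order_refl X4)
          show "\<bar>?X1\<bar> powr p \<le> Y1 w" unfolding Y1_def by (rule abs_mean_powr_le[OF p])
          show "\<bar>?X3\<bar> powr p \<le> e'" by (rule order_trans[OF abs_mean_powr_le[OF p] mean_le]) (rule ca)
        qed simp
        finally show ?thesis .
      qed
      have "(\<integral>w. \<bar>(\<Sum>i<n. H (y i) (\<theta> (l i) w)) / real n - ?I\<bar> powr p \<partial>P)
        \<le> (\<integral>w. 4 powr p * (Y1 w + \<bar>X2 w\<bar> powr p + e' + e') \<partial>P)"
      proof (rule integral_mono')
        show "integrable P (\<lambda>w. 4 powr p * (Y1 w + \<bar>X2 w\<bar> powr p + e' + e'))" using Y1i X2i by simp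
        show "0 \<le> 4 powr p * (Y1 w + \<bar>X2 w\<bar> powr p + e' + e')" for w
          using pointwise[of w] by (rule order_trans[rotated]) simp
      qed (rule pointwise)
      also have "\<dots> = 4 powr p * (integral\<^sup>L P Y1 + (\<integral>w. \<bar>X2 w\<bar> powr p \<partial>P) + e' + e')"
        using Y1i X2i by (simp add: prob_space)
      also have "\<dots> \<le> 4 powr p * (e' + e' + e' + e')"
        using Y1 X2 by (intro mult_left_mono add_mono) auto
      also have "\<dots> = e" unfolding e'_def by simp
      finally show "(\<integral>w. \<bar>(\<Sum>i<n. H ((\<tau> ^^ i) t) (\<theta> (k t i) w)) / real n
          - (\<integral>x. integral\<^sup>L P (H x) \<partial>\<mu>)\<bar> powr p \<partial>P) \<le> e"
        unfolding y_def l_def a_def .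
    qed
  qed
qed

section \<open>Dominated families and the final convergence\<close>

text \<open>A failure yields pairs of points at distance tending to 0 whose p-th moments stay at
  least \<open>e\<close>. Along a subsequence both members converge to one point, so almost sure
  continuity and domination by \<open>G\<close> force those moments to 0.\<close>

lemma uniform_Lp_continuity:
  fixes H :: "'m::metric_space \<Rightarrow> 'w \<Rightarrow> real"
  assumes cpt: "compact (UNIV :: 'm set)" and p: "0 < p"
    and Hm: "\<And>t. H t \<in> borel_measurable P"
    and Gm: "G \<in> borel_measurable P" and Gi: "integrable P (\<lambda>w. G w powr p)"
    and HG: "AE w in P. \<forall>t. \<bar>H t w\<bar> \<le> G w"
    and cont: "AE w in P. continuous_on UNIV (\<lambda>t. H t w)" and "e > 0"
  shows "\<exists>d>0. \<forall>s t. dist s t < d \<longrightarrow> (\<integral>w. \<bar>H s w - H t w\<bar> powr p \<partial>P) < e"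
proof (rule ccontr)
  assume neg: "\<not> ?thesis"
  have "\<exists>s t. dist s t < 1 / real (Suc n) \<and> \<not> (\<integral>w. \<bar>H s w - H t w\<bar> powr p \<partial>P) < e" for n
  proof -
    have "1 / real (Suc n) > 0" by simp
    with neg show ?thesis by blast
  qed
  then obtain s t where st: "\<And>n. dist (s n) (t n) < 1 / real (Suc n)"
    and bad: "\<And>n. \<not> (\<integral>w. \<bar>H (s n) w - H (t n) w\<bar> powr p \<partial>P) < e" by metis
  obtain x r where r: "strict_mono r" and sx: "(s \<circ> r) \<longlonglongrightarrow> x"
    using cpt unfolding compact_def by (metis UNIV_I)
  have "(\<lambda>n. dist (s n) (t n)) \<longlonglongrightarrow> 0"
    by (rule tendsto_sandwich[of "\<lambda>_. 0" _ _ "\<lambda>n. 1 / real (Suc n)"])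
      (use st lim_1_over_n[THEN LIMSEQ_Suc] in \<open>auto intro!: always_eventually less_imp_le simp del: of_nat_Suc\<close>)
  then have str: "(\<lambda>n. dist (s (r n)) (t (r n))) \<longlonglongrightarrow> 0"
    using LIMSEQ_subseq_LIMSEQ[OF _ r] by (fastforce simp: o_def)
  have sx0: "(\<lambda>n. dist (s (r n)) x) \<longlonglongrightarrow> 0" using sx by (simp add: tendsto_dist_iff[of "s \<circ> r"])
  have "(\<lambda>n. dist (t (r n)) x) \<longlonglongrightarrow> 0"
  proof (rule Lim_null_comparison)
    show "(\<lambda>n. dist (s (r n)) (t (r n)) + dist (s (r n)) x) \<longlonglongrightarrow> 0" using tendsto_add[OF str sx0] by simp
    show "\<forall>\<^sub>F n in sequentially. norm (dist (t (r n)) x) \<le> dist (s (r n)) (t (r n)) + dist (s (r n)) x"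
      by (intro always_eventually allI) (simp add: dist_triangle3)
  qed
  then have tx: "(t \<circ> r) \<longlonglongrightarrow> x" by (simp add: tendsto_dist_iff[of "t \<circ> r"])
  note [measurable] = Hm Gm
  have "(\<lambda>n. \<integral>w. \<bar>H (s (r n)) w - H (t (r n)) w\<bar> powr p \<partial>P) \<longlonglongrightarrow> (\<integral>w. 0 \<partial>P)"
  proof (rule integral_dominated_convergence[where w = "\<lambda>w. 2 powr p * G w powr p"])
    show "AE w in P. (\<lambda>n. \<bar>H (s (r n)) w - H (t (r n)) w\<bar> powr p) \<longlonglongrightarrow> 0"
      using cont
    proof eventually_elim
      case (elim w)
      have "(\<lambda>n. \<bar>H (s (r n)) w - H (t (r n)) w\<bar>) \<longlonglongrightarrow> \<bar>H x w - H x w\<bar>"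
        using continuous_on_tendsto_compose[OF elim sx] continuous_on_tendsto_compose[OF elim tx]
        by (intro tendsto_intros) (auto simp: o_def)
      then have "(\<lambda>n. \<bar>H (s (r n)) w - H (t (r n)) w\<bar>) \<longlonglongrightarrow> 0" by simp
      from tendsto_powr2[OF this tendsto_const[of p]] p show ?case by simp
    qed
    show "AE w in P. norm (\<bar>H (s (r n)) w - H (t (r n)) w\<bar> powr p) \<le> 2 powr p * G w powr p" for n
      using HG
    proof eventually_elim
      case (elim w)
      have "\<bar>H (s (r n)) w - H (t (r n)) w\<bar> \<le> 2 * G w"
        using elim[rule_format, of "s (r n)"] elim[rule_format, of "t (r n)"] by linarith
      then have "\<bar>H (s (r n)) w - H (t (r n)) w\<bar> powr p \<le> (2 * G w) powr p" using p by (intro powr_mono2) auto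
      then show ?case by (simp add: powr_mult)
    qed
  qed (use Gi in auto)
  then have "\<forall>\<^sub>F n in sequentially. (\<integral>w. \<bar>H (s (r n)) w - H (t (r n)) w\<bar> powr p \<partial>P) < e"
    using \<open>e > 0\<close> by (auto dest: order_tendstoD(2))
  then show False using bad eventually_happens'[OF sequentially_bot] by fastforce
qed

theorem theorem4p9:
  fixes \<tau> :: "'m::metric_space \<Rightarrow> 'm" and \<mu> :: "'m measure"
    and P :: "'w measure" and \<theta> :: "int ^ 'd \<Rightarrow> 'w \<Rightarrow> 'w"
    and \<kappa> :: "'m \<Rightarrow> int ^ 'd" and p :: real
    and F :: "'m \<times> 'w \<Rightarrow> real"
  assumes cpt: "compact (UNIV :: 'm set)"
    and sep: "\<exists>D::'m set. countable D \<and> closure D = UNIV"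
    and cont: "continuous_on UNIV \<tau>"
    and ue: "uniquely_ergodic \<tau>"
    and mu: "invariant_borel_prob \<tau> \<mu>"
    and P: "prob_space P"
    and grp: "pres_group P \<theta>"
    and mix: "strongly_mixing P \<theta>"
    and kmeas: "\<kappa> \<in> measurable borel (count_space UNIV)"
    and kcond: "\<And>m::nat. ((\<lambda>n. (SUP t. real (card {(i, j). 1 \<le> i \<and> i \<le> n \<and> 1 \<le> j \<and> j \<le> n \<and>
                    maxnorm (kappa_sum \<tau> \<kappa> i t - kappa_sum \<tau> \<kappa> j t) \<le> int m}))
                  / (real n)\<^sup>2) \<longlonglongrightarrow> 0)"
    and p: "1 \<le> p"
    and Fmeas: "F \<in> borel_measurable (borel \<Otimes>\<^sub>M P)"
    and supmeas: "(\<lambda>\<omega>. \<Squnion>t. ennreal \<bar>F (t, \<omega>)\<bar>) \<in> borel_measurable P"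
    and supfin: "AE \<omega> in P. (\<Squnion>t. ennreal \<bar>F (t, \<omega>)\<bar>) < \<top>"
    and supLp: "integrable P (\<lambda>\<omega>. enn2real (\<Squnion>t. ennreal \<bar>F (t, \<omega>)\<bar>) powr p)"
    and Fcont: "AE \<omega> in P. continuous_on UNIV (\<lambda>t. F (t, \<omega>))"
  shows "(\<lambda>n. SUP t. (\<integral>\<omega>. \<bar>(1 / real n) * (\<Sum>i<n. F ((\<tau> ^^ i) t, \<theta> (kappa_sum \<tau> \<kappa> i t) \<omega>))
                 - integral\<^sup>L (\<mu> \<Otimes>\<^sub>M P) F\<bar> powr p \<partial>P) powr (1 / p)) \<longlonglongrightarrow> 0"
proof -
  interpret prob_space P by fact
  have \<mu>: "prob_space \<mu>" "sets \<mu> = sets borel" using mu unfolding invariant_borel_prob_def by auto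
  interpret \<mu>: prob_space \<mu> by fact
  interpret pair_sigma_finite \<mu> P ..
  have Fm[measurable]: "F \<in> borel_measurable (\<mu> \<Otimes>\<^sub>M P)"
    using Fmeas measurable_cong_sets[OF sets_pair_measure_cong[OF \<mu>(2) refl] refl] by blast
  define H where "H t w = F (t, w)" for t w
  \<comment> \<open>Because \<open>enn2real\<close> sends infinity to 0, \<open>G\<close> dominates
    the sections only where the supremum is finite, that is almost everywhere by
    \<open>supfin\<close>.\<close>
  define G where "G w = enn2real (\<Squnion>t. ennreal \<bar>F (t, w)\<bar>)" for w
  have Hm: "H t \<in> borel_measurable P" for t
    unfolding H_def using measurable_Pair2[OF Fmeas, of t] by simp
  have Gm: "G \<in> borel_measurable P" unfolding G_def using supmeas by simp
  have Gi: "integrable P (\<lambda>w. G w powr p)" using supLp unfolding G_def .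
  have G0: "0 \<le> G w" for w unfolding G_def by simp
  have HG: "AE w in P. \<forall>t. \<bar>H t w\<bar> \<le> G w"
    using supfin
  proof eventually_elim
    case (elim w)
    have "enn2real (ennreal \<bar>F (t, w)\<bar>) \<le> enn2real (\<Squnion>t. ennreal \<bar>F (t, w)\<bar>)" for t
      by (rule enn2real_mono[OF SUP_upper elim]) simp
    then show ?case unfolding H_def G_def by simp
  qed
  have Hi: "integrable P (\<lambda>w. \<bar>H t w\<bar> powr p)" for t
  proof (rule Bochner_Integration.integrable_bound[OF Gi])
    show "AE w in P. norm (\<bar>H t w\<bar> powr p) \<le> norm (G w powr p)"
      using HG by eventually_elim (use p in \<open>auto intro!: powr_mono2\<close>)
  qed (use Hm in measurable)
  have Hc: "\<exists>d>0. \<forall>s t. dist s t < d \<longrightarrow> (\<integral>w. \<bar>H s w - H t w\<bar> powr p \<partial>P) < e" if "e > 0" for e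
    by (rule uniform_Lp_continuity[OF cpt _ Hm Gm Gi HG _ that]) (use p Fcont in \<open>auto simp: H_def\<close>)
  have H1: "integrable P (H t)" for t by (rule integrable_of_abs_powr[OF p Hm Hi])
  have G1: "integrable P G" by (rule integrable_of_abs_powr[OF p Gm]) (use Gi G0 in simp)
  \<comment> \<open>The inner integrals of the absolute value are bounded by the mean of
    \<open>G\<close>, uniformly in \<open>t\<close>. Fubini then turns the product mean into the
    iterated integral used above.\<close>
  have "integrable (\<mu> \<Otimes>\<^sub>M P) F"
  proof (rule Fubini_integrable[OF Fm])
    have "\<bar>\<integral>w. norm (F (t, w)) \<partial>P\<bar> \<le> integral\<^sup>L P G" for t
    proof -
      have "(\<integral>w. norm (F (t, w)) \<partial>P) \<le> integral\<^sup>L P G"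
        using HG H1[of t] G1 unfolding H_def by (intro integral_mono_AE integrable_norm) auto
      then show ?thesis by (simp add: abs_of_nonneg)
    qed
    then show "integrable \<mu> (\<lambda>t. \<integral>w. norm (F (t, w)) \<partial>P)"
      by (intro \<mu>.integrable_const_bound[of _ "integral\<^sup>L P G"]) auto
    show "AE t in \<mu>. integrable P (\<lambda>w. F (t, w))" using H1 unfolding H_def by simp
  qed
  then have fub: "integral\<^sup>L (\<mu> \<Otimes>\<^sub>M P) F = (\<integral>x. integral\<^sup>L P (H x) \<partial>\<mu>)"
    unfolding H_def by (rule integral_fst'[symmetric])
  note rare = rare_returns[OF kcond]
  define J where "J n t = (\<integral>\<omega>. \<bar>(1 / real n) * (\<Sum>i<n. F ((\<tau> ^^ i) t, \<theta> (kappa_sum \<tau> \<kappa> i t) \<omega>))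
                 - integral\<^sup>L (\<mu> \<Otimes>\<^sub>M P) F\<bar> powr p \<partial>P) powr (1 / p)" for n t
  have J: "\<forall>\<^sub>F n in sequentially. \<forall>t. J n t \<le> e" if "e > 0" for e
  proof -
    \<comment> \<open>The p-th root in \<open>J\<close> turns this tolerance for the p-th moment
      into \<open>e\<close>.\<close>
    have "e powr p > 0" using that by simp
    then have "\<forall>\<^sub>F n in sequentially. \<forall>t. (\<integral>w. \<bar>(\<Sum>i<n. H ((\<tau> ^^ i) t) (\<theta> (kappa_sum \<tau> \<kappa> i t) w)) / real n
        - (\<integral>x. integral\<^sup>L P (H x) \<partial>\<mu>)\<bar> powr p \<partial>P) \<le> e powr p"
      by (intro uniform_Lp_ergodic[where k = "\<lambda>t i. kappa_sum \<tau> \<kappa> i t"] cpt ue mu P grp mix rare p Hm Hi Hc)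
    then show ?thesis
    proof eventually_elim
      case (elim n)
      have "J n t \<le> (e powr p) powr (1/p)" for t
        unfolding J_def fub using elim p by (intro powr_mono2) (auto simp: H_def)
      then show ?case using that p by (simp add: powr_powr)
    qed
  qed
  have "(\<lambda>n. SUP t. J n t) \<longlonglongrightarrow> 0"
  proof (rule tendstoI)
    fix e :: real assume "e > 0"
    then have "e/2 > 0" by simp
    from J[OF this] show "\<forall>\<^sub>F n in sequentially. dist (SUP t. J n t) 0 < e"
    proof eventually_elim
      case (elim n)
      have "(SUP t. J n t) \<le> e/2" using elim by (intro cSUP_least) auto
      \<comment> \<open>Nonnegative members bound a real supremum from below only if the family is
        bounded above, which the uniform bound \<open>e/2\<close> provides.\<close>
      moreover have "0 \<le> (SUP t. J n t)"
        using elim by (intro cSUP_upper2[of _ _ undefined]) (auto simp: J_def intro!: bdd_aboveI2[of _ _ "e/2"])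
      ultimately show ?case using \<open>e > 0\<close> by (simp add: dist_real_def)
    qed
  qed
  then show ?thesis unfolding J_def .
qed

end
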